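(* Let $S\in\mathcal{Q}(\mathcal{K},\Gamma)$ and write it as $S=\begin{pmatrix} S_{11} & S_{12}\\ S_{21} & S_{22}\end{pmatrix}$ according to the decomposition $\mathcal{K}=\ell^{2}(\mathfrak{X})\oplus\ell^{2}(\mathfrak{X})$. Then there exists a Pfaffian point process $M^{S}$ on $\mathfrak{X}$ such that each correlation function is given by $$\rho^{M^{S}}_{n}(x_{1},\dots,x_{n})=\mathrm{Pf}\,[\mathbb{K}_{S}(x_{i},x_{j})]_{1\le i,j\le n},$$ where $$\mathbb{K}_{S}(x,y)=\begin{pmatrix}(e_{x},S_{21}e_{y})_{\ell^{2}(\mathfrak{X})} & (e_{x},S_{22}e_{y})_{\ell^{2}(\mathfrak{X})}\\ (e_{x},(S_{11}-1)e_{y})_{\ell^{2}(\mathfrak{X})} & (e_{x},S_{12}e_{y})_{\ell^{2}(\mathfrak{X})}\end{pmatrix},\qquad x,y\in\mathfrak{X}.$$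
   Context: $\mathfrak{X}$ is a countable set, $\Omega=\{0,1\}^{\mathfrak{X}}$ carries the product topology and its Borel $\sigma$-algebra $\Sigma$; $\omega\in\Omega$ is identified with the subset $\{x:\omega(x)=1\}$ of $\mathfrak{X}$. For a probability measure $M$ on $(\Omega,\Sigma)$ and $n\in\mathbb{N}$, the $n$-point correlation function is $\rho^{M}_{n}(x_{1},\dots,x_{n})=M(\{\omega:\omega(x_{1})=\cdots=\omega(x_{n})=1\})$ for distinct $x_{1},\dots,x_{n}\in\mathfrak{X}$, extended by $0$ when two points coincide. For $\mathbb{K}:\mathfrak{X}\times\mathfrak{X}\to M(2;\mathbb{C})$ with $\mathbb{K}(x,y)^{\mathrm{T}}=-\mathbb{K}(y,x)$, $[\mathbb{K}(x_{i},x_{j})]_{1\le i,j\le n}$ denotes the antisymmetric $2n\times 2n$ matrix whose $(i,j)$-th $2\times 2$ block is $\mathbb{K}(x_{i},x_{j})$, and $\mathrm{Pf}$ is its Pfaffian. $M$ is a Pfaffian point process (on $\mathfrak{X}$) if there is such a $\mathbb{K}$ with $\rho^{M}_{n}(x_{1},\dots,x_{n})=\mathrm{Pf}[\mathbb{K}(x_{i},x_{j})]_{1\le i,j\le n}$ for all $n\in\mathbb{N}$. $e_{x}\in\ell^{2}(\mathfrak{X})$ is $e_{x}(y)=\delta_{x,y}$; inner products are linear in the second argument. $J$ is the complex conjugation on $\ell^{2}(\mathfrak{X})$ (antilinear, fixing each $e_{x}$). $\mathcal{K}=\ell^{2}(\mathfrak{X})\oplus\ell^{2}(\mathfrak{X})$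 with the anti-unitary involution $\Gamma=\begin{pmatrix}0 & J\\ J & 0\end{pmatrix}$. For bounded $A$ on $\mathcal{K}$, $\overline{A}:=\Gamma A\Gamma$. $\mathcal{Q}(\mathcal{K},\Gamma)=\{S \text{ bounded on }\mathcal{K}: 0\le S=S^{\ast}\le 1,\ \overline{S}=1-S\}$. *)

theory Defs
  imports "HOL-Probability.Probability" "HOL-Combinatorics.Permutations"
begin

typedef 'x ell2 = "{f :: 'x \<Rightarrow> complex. (\<lambda>x. (cmod (f x))\<^sup>2) summable_on UNIV}"
  morphisms ell2_app Abs_ell2
  by (rule exI[of _ "\<lambda>_. 0"]) simp

setup_lifting type_definition_ell2

lemma square_summable_scale:
  fixes f :: "'x \<Rightarrow> complex"
  assumes "(\<lambda>x. (cmod (f x))\<^sup>2) summable_on UNIV"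
  shows "(\<lambda>x. (cmod (c * f x))\<^sup>2) summable_on UNIV"
  using summable_on_cmult_right[OF assms, of "(cmod c)\<^sup>2"]
  by (simp add: norm_mult power_mult_distrib)

lemma square_summable_add:
  fixes f g :: "'x \<Rightarrow> complex"
  assumes f: "(\<lambda>x. (cmod (f x))\<^sup>2) summable_on UNIV"
    and g: "(\<lambda>x. (cmod (g x))\<^sup>2) summable_on UNIV"
  shows "(\<lambda>x. (cmod (f x + g x))\<^sup>2) summable_on UNIV"
proof (rule summable_on_comparison_test)
  show "(\<lambda>x. 2 * ((cmod (f x))\<^sup>2 + (cmod (g x))\<^sup>2)) summable_on UNIV"
    by (intro summable_on_cmult_right summable_on_add f g)
  fix x
  have "(cmod (f x + g x))\<^sup>2 \<le> (cmod (f x) + cmod (g x))\<^sup>2"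
    by (intro power_mono norm_triangle_ineq) auto
  also have "\<dots> \<le> 2 * ((cmod (f x))\<^sup>2 + (cmod (g x))\<^sup>2)"
    using sum_squares_bound[of "cmod (f x)" "cmod (g x)"] by (simp add: power2_sum)
  finally show "(cmod (f x + g x))\<^sup>2 \<le> 2 * ((cmod (f x))\<^sup>2 + (cmod (g x))\<^sup>2)" .
qed auto

lemma square_summable_prod:
  fixes f g :: "'x \<Rightarrow> complex"
  assumes f: "(\<lambda>x. (cmod (f x))\<^sup>2) summable_on UNIV"
    and g: "(\<lambda>x. (cmod (g x))\<^sup>2) summable_on UNIV"
  shows "(\<lambda>x. cnj (f x) * g x) summable_on UNIV"
proof (rule abs_summable_summable, rule abs_summable_product)
  show "(\<lambda>x. norm (cnj (f x) * cnj (f x))) summable_on UNIV"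
    using f by (simp add: norm_mult power2_eq_square)
  show "(\<lambda>x. norm (g x * g x)) summable_on UNIV"
    using g by (simp add: norm_mult power2_eq_square)
qed

lift_definition ell2_cscale :: "complex \<Rightarrow> 'x ell2 \<Rightarrow> 'x ell2"
  is "\<lambda>c f x. c * f x"
  by (rule square_summable_scale)

text \<open>The inner product is antilinear in the first and linear in the second argument.\<close>

lift_definition ell2_cinner :: "'x ell2 \<Rightarrow> 'x ell2 \<Rightarrow> complex"
  is "\<lambda>f g. \<Sum>\<^sub>\<infinity>x. cnj (f x) * g x" .

lift_definition ell2_conj :: "'x ell2 \<Rightarrow> 'x ell2"
  is "\<lambda>f x. cnj (f x)"
  by simp

lift_definition ell2_basis :: "'x \<Rightarrow> 'x ell2"
  is "\<lambda>x y. if y = x then 1 else 0"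
proof -
  fix x :: 'x
  have "(\<lambda>y. (cmod (if y = x then 1 else 0))\<^sup>2) summable_on {x}"
    by simp
  then show "(\<lambda>y. (cmod (if y = x then 1 else 0))\<^sup>2) summable_on UNIV"
    by (rule summable_on_cong_neutral[THEN iffD1, rotated -1]) auto
qed

instantiation ell2 :: (type) real_vector
begin

lift_definition zero_ell2 :: "'a ell2" is "\<lambda>_. 0" by simp

lift_definition plus_ell2 :: "'a ell2 \<Rightarrow> 'a ell2 \<Rightarrow> 'a ell2"
  is "\<lambda>f g x. f x + g x"
  by (rule square_summable_add)

lift_definition uminus_ell2 :: "'a ell2 \<Rightarrow> 'a ell2"
  is "\<lambda>f x. - f x" by simp

lift_definition minus_ell2 :: "'a ell2 \<Rightarrow> 'a ell2 \<Rightarrow> 'a ell2"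
  is "\<lambda>f g x. f x - g x"
  subgoal for f g
    using square_summable_add[of f "\<lambda>x. - g x"] by simp
  done

lift_definition scaleR_ell2 :: "real \<Rightarrow> 'a ell2 \<Rightarrow> 'a ell2"
  is "\<lambda>r f x. r *\<^sub>R f x"
  unfolding scaleR_conv_of_real by (rule square_summable_scale)

instance
  by standard (transfer; simp add: fun_eq_iff algebra_simps)+

end

lemma ell2_cinner_summable:
  "(\<lambda>x. cnj (ell2_app f x) * ell2_app g x) summable_on UNIV"
  using ell2_app[of f] ell2_app[of g] by (intro square_summable_prod) auto

lemma ell2_cinner_add_left: "ell2_cinner (f + g) h = ell2_cinner f h + ell2_cinner g h"
  using infsum_add[OF ell2_cinner_summable[of f h] ell2_cinner_summable[of g h]]
  by (simp add: ell2_cinner.rep_eq plus_ell2.rep_eq algebra_simps)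

lemma ell2_cinner_commute: "ell2_cinner f g = cnj (ell2_cinner g f)"
  by (simp add: ell2_cinner.rep_eq flip: infsum_cnj) (simp add: mult.commute)

lemma ell2_cinner_scaleR_left: "ell2_cinner (r *\<^sub>R f) g = of_real r * ell2_cinner f g"
  by (simp add: ell2_cinner.rep_eq scaleR_ell2.rep_eq scaleR_conv_of_real mult.assoc
      infsum_cmult_right[OF ell2_cinner_summable])

lemma Re_ell2_cinner_self: "Re (ell2_cinner f f) = (\<Sum>\<^sub>\<infinity>x. (cmod (ell2_app f x))\<^sup>2)"
  unfolding ell2_cinner.rep_eq infsum_Re[OF ell2_cinner_summable, symmetric]
  unfolding cmod_power2 by (simp add: power2_eq_square)

text \<open>The underlying real inner product is the real part of the complex one, so that
  the norm is the usual one, and products of the space carry the norm of the Hilbert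
  space direct sum.\<close>

instantiation ell2 :: (type) real_inner
begin

definition "inner f g = Re (ell2_cinner f g)" for f g :: "'a ell2"
definition "norm f = sqrt (inner f f)" for f :: "'a ell2"
definition "sgn f = f /\<^sub>R norm f" for f :: "'a ell2"
definition "dist f g = norm (f - g)" for f g :: "'a ell2"
definition [code del]:
  "uniformity = (INF e\<in>{0<..}. principal {(f, g :: 'a ell2). dist f g < e})"
definition [code del]:
  "open (U :: 'a ell2 set) \<longleftrightarrow> (\<forall>f\<in>U. eventually (\<lambda>(f', g). f' = f \<longrightarrow> g \<in> U) uniformity)"

instance
proof
  fix f g h :: "'a ell2" and r :: real and U :: "'a ell2 set"
  show "inner f g = inner g f"
    unfolding inner_ell2_def by (subst ell2_cinner_commute) simp
  show "inner (f + g) h = inner f h + inner g h"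
    by (simp add: inner_ell2_def ell2_cinner_add_left)
  show "inner (r *\<^sub>R f) g = r * inner f g"
    by (simp add: inner_ell2_def ell2_cinner_scaleR_left)
  show "0 \<le> inner f f"
    by (simp add: inner_ell2_def Re_ell2_cinner_self infsum_nonneg)
  show "inner f f = 0 \<longleftrightarrow> f = 0"
  proof
    assume "inner f f = 0"
    then have "(\<Sum>\<^sub>\<infinity>x. (cmod (ell2_app f x))\<^sup>2) \<le> 0"
      by (simp add: inner_ell2_def Re_ell2_cinner_self)
    then have "(cmod (ell2_app f x))\<^sup>2 = 0" for x
      by (rule nonneg_infsum_le_0D) (use ell2_app[of f] in auto)
    then have "ell2_app f = ell2_app 0"
      by (auto simp: zero_ell2.rep_eq)
    then show "f = 0"
      by (simp add: ell2_app_inject)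
  qed (simp add: inner_ell2_def Re_ell2_cinner_self zero_ell2.rep_eq)
qed (rule norm_ell2_def sgn_ell2_def dist_ell2_def uniformity_ell2_def open_ell2_def)+

end

type_synonym 'x dbl = "'x ell2 \<times> 'x ell2"

definition dbl_cscale :: "complex \<Rightarrow> 'x dbl \<Rightarrow> 'x dbl" where
  "dbl_cscale c v = (ell2_cscale c (fst v), ell2_cscale c (snd v))"

definition dbl_cinner :: "'x dbl \<Rightarrow> 'x dbl \<Rightarrow> complex" where
  "dbl_cinner v w = ell2_cinner (fst v) (fst w) + ell2_cinner (snd v) (snd w)"

definition bounded_clinear_op :: "('x dbl \<Rightarrow> 'x dbl) \<Rightarrow> bool" where
  "bounded_clinear_op A \<longleftrightarrow>
     bounded_linear A \<and> (\<forall>c v. A (dbl_cscale c v) = dbl_cscale c (A v))"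

definition selfadjoint_op :: "('x dbl \<Rightarrow> 'x dbl) \<Rightarrow> bool" where
  "selfadjoint_op A \<longleftrightarrow> (\<forall>v w. dbl_cinner v (A w) = dbl_cinner (A v) w)"

definition op_le :: "('x dbl \<Rightarrow> 'x dbl) \<Rightarrow> ('x dbl \<Rightarrow> 'x dbl) \<Rightarrow> bool" where
  "op_le A B \<longleftrightarrow> (\<forall>v. dbl_cinner v (B v - A v) \<in> \<real>\<^sub>\<ge>\<^sub>0)"

definition Gamma :: "'x dbl \<Rightarrow> 'x dbl" where
  "Gamma v = (ell2_conj (snd v), ell2_conj (fst v))"

definition op_bar :: "('x dbl \<Rightarrow> 'x dbl) \<Rightarrow> ('x dbl \<Rightarrow> 'x dbl)" where
  "op_bar A = Gamma \<circ> A \<circ> Gamma"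

definition Q_set :: "('x dbl \<Rightarrow> 'x dbl) set" where
  "Q_set = {S. bounded_clinear_op S \<and> op_le (\<lambda>_. 0) S \<and> selfadjoint_op S \<and> op_le S id
     \<and> op_bar S = (\<lambda>v. v - S v)}"

definition block11 :: "('x dbl \<Rightarrow> 'x dbl) \<Rightarrow> 'x ell2 \<Rightarrow> 'x ell2" where
  "block11 A f = fst (A (f, 0))"

definition block12 :: "('x dbl \<Rightarrow> 'x dbl) \<Rightarrow> 'x ell2 \<Rightarrow> 'x ell2" where
  "block12 A f = fst (A (0, f))"

definition block21 :: "('x dbl \<Rightarrow> 'x dbl) \<Rightarrow> 'x ell2 \<Rightarrow> 'x ell2" where
  "block21 A f = snd (A (f, 0))"

definition block22 :: "('x dbl \<Rightarrow> 'x dbl) \<Rightarrow> 'x ell2 \<Rightarrow> 'x ell2" where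
  "block22 A f = snd (A (0, f))"

text \<open>The Pfaffian of a \<open>2n \<times> 2n\<close> antisymmetric matrix, with rows and columns
  indexed from 0.\<close>

definition pfaffian :: "nat \<Rightarrow> (nat \<Rightarrow> nat \<Rightarrow> complex) \<Rightarrow> complex" where
  "pfaffian n A =
     (\<Sum>p | p permutes {..<2 * n}. of_int (sign p) * (\<Prod>i<n. A (p (2 * i)) (p (2 * i + 1))))
     / (2 ^ n * fact n)"

type_synonym 'x kernel = "'x \<Rightarrow> 'x \<Rightarrow> complex^2^2"

definition antisymmetric_kernel :: "'x kernel \<Rightarrow> bool" where
  "antisymmetric_kernel K \<longleftrightarrow> (\<forall>x y. transpose (K x y) = - K y x)"

text \<open>Entry \<open>(p, q)\<close>, counted from 0, of the block matrix with blocks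
  \<open>K (x i) (x j)\<close>.\<close>

definition block_matrix :: "'x kernel \<Rightarrow> (nat \<Rightarrow> 'x) \<Rightarrow> nat \<Rightarrow> nat \<Rightarrow> complex" where
  "block_matrix K x p q =
     K (x (p div 2)) (x (q div 2)) $ (if even p then 1 else 2) $ (if even q then 1 else 2)"

text \<open>Configurations are functions into \<open>bool\<close> (discrete), and \<open>borel\<close> on the function
  space refers to the product topology. The points are \<open>x 0, \<dots>, x (n - 1)\<close>.\<close>

definition correlation :: "('x \<Rightarrow> bool) measure \<Rightarrow> nat \<Rightarrow> (nat \<Rightarrow> 'x) \<Rightarrow> real" where
  "correlation M n x = (if inj_on x {..<n} then measure M {\<omega>. \<forall>i<n. \<omega> (x i)} else 0)"

definition pfaffian_point_process :: "('x :: countable \<Rightarrow> bool) measure \<Rightarrow> bool" where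
  "pfaffian_point_process M \<longleftrightarrow>
     prob_space M \<and> sets M = sets borel \<and>
     (\<exists>K. antisymmetric_kernel K \<and>
        (\<forall>n x. complex_of_real (correlation M n x) = pfaffian n (block_matrix K x)))"

definition kernel_of :: "('x dbl \<Rightarrow> 'x dbl) \<Rightarrow> 'x kernel" where
  "kernel_of S x y = vector
     [vector [ell2_cinner (ell2_basis x) (block21 S (ell2_basis y)),
              ell2_cinner (ell2_basis x) (block22 S (ell2_basis y))],
      vector [ell2_cinner (ell2_basis x) (block11 S (ell2_basis y) - ell2_basis y),
              ell2_cinner (ell2_basis x) (block12 S (ell2_basis y))]]"

end

theory Submission
  imports Defs
begin

text \<open>
  The claim is linear algebra on finite sets of points, plus a projective limit. Index the basis
  vectors of \<open>\<K> = \<ell>\<^sup>2 \<oplus> \<ell>\<^sup>2\<close> by pairs \<open>(x, t)\<close>, where \<open>t\<close> says whether the vector lies in the second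
  copy, and put \<open>s u v = (e\<^sub>u, S e\<^sub>v)\<close>. Up to the correction \<open>S\<^sub>1\<^sub>1 - 1\<close> in one block, the kernel is this
  form with its first argument moved to the other copy. What is used of \<open>S\<close> is that \<open>s\<close> is Hermitian
  and positive semidefinite and that exchanging the copies turns \<open>s\<close> into the transpose of \<open>1 - s\<close>;
  such forms are called quasifree below.

  \<^emph>\<open>Positivity of the Pfaffians.\<close> The Pfaffian over \<open>n + 1\<close> points is \<open>r = s b b\<close>, where \<open>b = (y, True)\<close>
  belongs to the last point \<open>y\<close>, times the Pfaffian over \<open>n\<close> points of a Schur complement
  (\<open>pfaffian_Schur_complement\<close>). That Schur complement again comes from a quasifree form, namely
  \<open>s\<close> minus \<open>s u b * s b v / r\<close> plus \<open>s u a * s a v / r\<close> with \<open>a = (y, False)\<close>: the first correction gives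
  the usual Schur complement of a positive form, the second one adds a positive form of rank one, and
  exchanging the copies exchanges the two corrections (\<open>quasifree_condition\<close>). In terms of the point
  process this is conditioning on a particle at \<open>y\<close>. If \<open>r = 0\<close>, positivity makes a whole row of the
  matrix vanish. So all the Pfaffians are nonnegative by induction (\<open>pfaffian_pairing_nonneg\<close>).

  \<^emph>\<open>The probabilities of configurations.\<close> Exchanging the two copies at the points of a set \<open>C\<close> is a
  particle-hole transformation and again yields a quasifree form. The probability that the configuration
  restricted to a finite set \<open>X\<close> equals \<open>A\<close> is the Pfaffian over \<open>X\<close> for the form transformed on \<open>X - A\<close>.
  It is nonnegative by the above. The matrices before and after a transformation at one point differ,
  after an exchange of two rows and columns, by the standard symplectic block at that point, so that
  the two Pfaffians add up to the Pfaffian without that point (\<open>pfaffian_particle_hole\<close>). This is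
  precisely consistency of the finite-dimensional distributions, and Kolmogorov's extension theorem
  gives the measure (\<open>exists_configuration_measure\<close>). For \<open>A = X\<close> nothing is transformed, and the
  probability is the required correlation function.
\<close>

section \<open>Pfaffians\<close>

text \<open>
  Diagonal entries do not occur in the defining sum, because permutations are injective.
\<close>

lemma pfaffian_cong:
  assumes "\<And>p q. p < 2 * n \<Longrightarrow> q < 2 * n \<Longrightarrow> p \<noteq> q \<Longrightarrow> A p q = B p q"
  shows "pfaffian n A = pfaffian n B"
proof -
  have "A (p (2 * i)) (p (2 * i + 1)) = B (p (2 * i)) (p (2 * i + 1))"
    if "p permutes {..<2 * n}" "i < n" for p i
  proof (rule assms)
    show "p (2 * i) < 2 * n" "p (2 * i + 1) < 2 * n"
      using permutes_in_image[OF that(1), of "2 * i"] permutes_in_image[OF that(1), of "2 * i + 1"]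
        that(2) by simp_all
    show "p (2 * i) \<noteq> p (2 * i + 1)"
      using permutes_inj[OF that(1)] by (auto dest!: injD)
  qed
  then show ?thesis
    unfolding pfaffian_def by (intro arg_cong2[where f = "(/)"] sum.cong refl) simp
qed

lemma pfaffian_permute:
  assumes q: "q permutes {..<2 * n}"
  shows "pfaffian n (\<lambda>i j. A (q i) (q j)) = of_int (sign q) * pfaffian n A"
proof -
  let ?P = "{p. p permutes {..<2 * n}}"
  let ?f = "\<lambda>p. of_int (sign p) * (\<Prod>i<n. A (p (2 * i)) (p (2 * i + 1)))"
  have sgn: "sign p = sign q * sign (q \<circ> p)" if "p \<in> ?P" for p
  proof -
    have "permutation p" "permutation q"
      using that q by (auto intro: permutation_permutes[THEN iffD2])
    then show ?thesis by (simp add: sign_compose)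
  qed
  have "(\<Sum>p\<in>?P. of_int (sign p) * (\<Prod>i<n. A (q (p (2 * i))) (q (p (2 * i + 1)))))
      = (\<Sum>p\<in>?P. of_int (sign q) * ?f (q \<circ> p))"
    by (intro sum.cong refl, subst sgn) auto
  also have "\<dots> = of_int (sign q) * sum ?f ?P"
    unfolding setum_permutations_compose_left[OF q, of ?f] by (simp only: sum_distrib_left)
  finally show ?thesis
    by (simp add: pfaffian_def)
qed

text \<open>
  Exchanging the two indices leaves all off-diagonal entries alone and changes the sign of the Pfaffian.
\<close>

lemma pfaffian_equal_rows:
  assumes ab: "a < 2 * n" "b < 2 * n" "a \<noteq> b"
    and eq: "\<And>q. q \<noteq> a \<Longrightarrow> q \<noteq> b \<Longrightarrow> A a q = A b q" "\<And>q. q \<noteq> a \<Longrightarrow> q \<noteq> b \<Longrightarrow> A q a = A q b"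
    and sym: "A a b = A b a"
  shows "pfaffian n A = 0"
proof -
  have t: "Transposition.transpose a b permutes {..<2 * n}"
    using ab by (intro permutes_swap_id) auto
  have "pfaffian n A = pfaffian n (\<lambda>i j. A (Transposition.transpose a b i) (Transposition.transpose a b j))"
  proof (rule pfaffian_cong)
    fix p q :: nat
    assume "p \<noteq> q"
    then consider "p = a" "q = b" | "p = b" "q = a" | "p = a" "q \<noteq> a" "q \<noteq> b" | "p = b" "q \<noteq> a" "q \<noteq> b"
      | "q = a" "p \<noteq> a" "p \<noteq> b" | "q = b" "p \<noteq> a" "p \<noteq> b" | "p \<noteq> a" "p \<noteq> b" "q \<noteq> a" "q \<noteq> b"
      by blast
    then show "A p q = A (Transposition.transpose a b p) (Transposition.transpose a b q)"
      by cases (simp_all add: eq[symmetric] sym[symmetric])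
  qed
  also have "\<dots> = - pfaffian n A"
    unfolding pfaffian_permute[OF t, of A] using ab(3) by (simp only: sign_swap_id if_False) simp
  finally have "pfaffian n A + pfaffian n A = 0"
    by (simp only: eq_neg_iff_add_eq_0)
  then show ?thesis by simp
qed

text \<open>
  Each index occurs in exactly one factor of each summand, so the Pfaffian is linear in row \<open>k\<close> when
  column \<open>k\<close> is changed along with it.
\<close>

lemma pfaffian_linear:
  assumes k: "k < 2 * n"
    and off: "\<And>p q. p \<noteq> k \<Longrightarrow> q \<noteq> k \<Longrightarrow> A p q = C p q" "\<And>p q. p \<noteq> k \<Longrightarrow> q \<noteq> k \<Longrightarrow> B p q = C p q"
    and row: "\<And>q. q \<noteq> k \<Longrightarrow> C k q = c * A k q + d * B k q"
    and col: "\<And>q. q \<noteq> k \<Longrightarrow> C q k = c * A q k + d * B q k"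
  shows "pfaffian n C = c * pfaffian n A + d * pfaffian n B"
proof -
  let ?t = "\<lambda>A p. \<Prod>i<n. A (p (2 * i)) (p (2 * i + 1)) :: complex"
  have "?t C p = c * ?t A p + d * ?t B p" if p: "p permutes {..<2 * n}" for p
  proof -
    define j where "j = inv p k"
    have pj: "p m = k \<longleftrightarrow> m = j" for m
      unfolding j_def using permutes_inverses[OF p] by metis
    have "j < 2 * n"
      using permutes_in_image[OF permutes_inv[OF p], of k] k unfolding j_def by simp
    then have j2: "j div 2 < n" by linarith
    define i where "i = j div 2"
    have rest: "(\<Prod>m\<in>{..<n} - {i}. D (p (2 * m)) (p (2 * m + 1)))
        = (\<Prod>m\<in>{..<n} - {i}. C (p (2 * m)) (p (2 * m + 1)))"
      if "\<And>p q. p \<noteq> k \<Longrightarrow> q \<noteq> k \<Longrightarrow> D p q = C p q" for D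
    proof (rule prod.cong[OF refl])
      fix m assume "m \<in> {..<n} - {i}"
      then have "2 * m \<noteq> j" "2 * m + 1 \<noteq> j" unfolding i_def by auto
      then show "D (p (2 * m)) (p (2 * m + 1)) = C (p (2 * m)) (p (2 * m + 1))"
        by (intro that) (simp_all add: pj)
    qed
    have split: "?t D p = D (p (2 * i)) (p (2 * i + 1))
        * (\<Prod>m\<in>{..<n} - {i}. D (p (2 * m)) (p (2 * m + 1)))" for D
      using j2 unfolding i_def by (intro prod.remove) auto
    have "C (p (2 * i)) (p (2 * i + 1))
        = c * A (p (2 * i)) (p (2 * i + 1)) + d * B (p (2 * i)) (p (2 * i + 1))"
    proof (cases "even j")
      case True
      then have "2 * i = j" "2 * i + 1 \<noteq> j" unfolding i_def by auto
      then have "p (2 * i) = k" "p (2 * i + 1) \<noteq> k" by (simp_all only: pj not_False_eq_True)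
      then show ?thesis by (simp add: row)
    next
      case False
      then have "2 * i + 1 = j" unfolding i_def by auto
      then have "2 * i + 1 = j" "2 * i \<noteq> j" by auto
      then have "p (2 * i + 1) = k" "p (2 * i) \<noteq> k" by (simp_all only: pj not_False_eq_True)
      then show ?thesis by (simp add: col)
    qed
    moreover note rest[of A] rest[of B]
    ultimately show ?thesis
      unfolding split[of A] split[of B] split[of C] by (simp add: off algebra_simps)
  qed
  then have "(\<Sum>p | p permutes {..<2 * n}. of_int (sign p) * ?t C p)
     = c * (\<Sum>p | p permutes {..<2 * n}. of_int (sign p) * ?t A p)
     + d * (\<Sum>p | p permutes {..<2 * n}. of_int (sign p) * ?t B p)"
    unfolding sum_distrib_left sum.distrib[symmetric]
    by (intro sum.cong refl) (auto simp: algebra_simps)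
  then show ?thesis
    unfolding pfaffian_def by (simp add: add_divide_distrib)
qed

lemma pfaffian_zero_row:
  assumes "k < 2 * n" "\<And>q. q \<noteq> k \<Longrightarrow> A k q = 0" "\<And>q. q \<noteq> k \<Longrightarrow> A q k = 0"
  shows "pfaffian n A = 0"
  using pfaffian_linear[of k n A A A 0 0] assms by simp

text \<open>
  The exchange of the points \<open>i\<close> and \<open>j\<close> as it acts on matrix indices: point \<open>k\<close> owns the indices
  \<open>2 * k\<close> and \<open>2 * k + 1\<close>. It is a product of two transpositions, hence even.
\<close>

definition block_swap :: "nat \<Rightarrow> nat \<Rightarrow> nat \<Rightarrow> nat" where
  "block_swap i j = Transposition.transpose (2 * i) (2 * j) \<circ> Transposition.transpose (2 * i + 1) (2 * j + 1)"

lemma block_swap_apply: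
  "block_swap i j (2 * k) = 2 * Transposition.transpose i j k"
  "block_swap i j (2 * k + 1) = 2 * Transposition.transpose i j k + 1"
  unfolding block_swap_def Transposition.transpose_def o_def by (simp, presburger?)+

lemma block_swap_permutes:
  assumes "i < n" "j < n"
  shows "block_swap i j permutes {..<2 * n}"
  unfolding block_swap_def using assms by (intro permutes_compose permutes_swap_id) auto

lemma sign_block_swap: "sign (block_swap i j) = 1"
  unfolding block_swap_def by (subst sign_compose) (auto simp: sign_swap_id permutation_swap_id)

text \<open>
  A summand can only be nonzero if some pair \<open>(p (2 * i), p (2 * i + 1))\<close> consists of the last two
  indices. The \<open>n + 1\<close> positions \<open>i\<close> of this pair contribute equally, as do its two orders; this
  cancels against the quotient \<open>2 * (n + 1)\<close> of the two normalising factors. With the pair in the last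
  position and in increasing order, the permutations are those of the first \<open>2 * n\<close> indices.
\<close>

lemma pfaffian_direct_sum:
  assumes z: "\<And>q. q < 2 * n \<Longrightarrow> A q (2 * n) = 0" "\<And>q. q < 2 * n \<Longrightarrow> A (2 * n) q = 0"
    and s: "A (2 * n) (2 * n + 1) = r" "A (2 * n + 1) (2 * n) = - r"
  shows "pfaffian (Suc n) A = r * pfaffian n A"
proof -
  let ?a = "2 * n" and ?b = "2 * n + 1"
  let ?P = "{p. p permutes {..<2 * Suc n}}"
  let ?f = "\<lambda>p. of_int (sign p) * (\<Prod>i<Suc n. A (p (2 * i)) (p (2 * i + 1)))"
  \<comment> \<open>\<open>E p i\<close>: the pair at position \<open>i\<close> is sent to the last two indices, in either order.\<close>
  define E where "E p i \<longleftrightarrow> {p (2 * i), p (2 * i + 1)} = {?a, ?b}" for p :: "nat \<Rightarrow> nat" and i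
  have fin: "finite ?P" by (simp add: finite_permutations)
  have E_split: "?f p = (\<Sum>i<Suc n. if E p i then ?f p else 0)" if "p \<in> ?P" for p
  proof -
    from that have p: "p permutes {..<2 * Suc n}" by simp
    define j where "j = inv p ?a"
    define i where "i = j div 2"
    have pj: "p m = ?a \<longleftrightarrow> m = j" for m
      unfolding j_def using permutes_inverses[OF p] by metis
    have "j < 2 * Suc n"
      using permutes_in_image[OF permutes_inv[OF p], of ?a] unfolding j_def by simp
    then have i: "i < Suc n" unfolding i_def by (simp add: less_mult_imp_div_less mult.commute)
    have E_i: "m = i" if "E p m" for m
    proof -
      have "p (2 * m) = ?a \<or> p (2 * m + 1) = ?a"
        using that unfolding E_def by (auto simp: doubleton_eq_iff)
      then show ?thesis unfolding pj i_def by auto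
    qed
    have "?f p = 0" if "\<not> E p i"
    proof -
      have lt: "p (2 * i) < 2 * Suc n" "p (2 * i + 1) < 2 * Suc n"
        using permutes_in_image[OF p, of "2 * i"] permutes_in_image[OF p, of "2 * i + 1"] i by auto
      have ne: "p (2 * i) \<noteq> p (2 * i + 1)"
        using permutes_inj[OF p] by (auto dest!: injD)
      have "2 * i = j \<or> 2 * i + 1 = j" unfolding i_def by presburger
      then have "p (2 * i) = ?a \<or> p (2 * i + 1) = ?a" by (simp only: pj)
      then have "A (p (2 * i)) (p (2 * i + 1)) = 0"
      proof
        assume *: "p (2 * i) = ?a"
        with that lt ne have "p (2 * i + 1) < 2 * n" unfolding E_def by auto
        with * show ?thesis using z(2) by simp
      next
        assume *: "p (2 * i + 1) = ?a"
        with that lt ne have "p (2 * i) < 2 * n" unfolding E_def by auto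
        with * show ?thesis using z(1) by simp
      qed
      then show ?thesis using i by (simp add: prod_zero_iff del: prod.lessThan_Suc) blast
    qed
    then have "(if E p i then ?f p else 0) = ?f p" by auto
    moreover have "(\<Sum>m<Suc n. if E p m then ?f p else 0) = (\<Sum>m<Suc n. if m = i then (if E p i then ?f p else 0) else 0)"
      by (intro sum.cong refl) (auto dest: E_i)
    ultimately show ?thesis using i by (simp add: sum.delta del: sum.lessThan_Suc)
  qed
  have E_move: "(\<Sum>p\<in>?P. if E p i then ?f p else 0) = (\<Sum>p\<in>?P. if E p n then ?f p else 0)"
    if i: "i < Suc n" for i
  proof -
    let ?q = "block_swap i n"
    have q: "?q permutes {..<2 * Suc n}" using i by (intro block_swap_permutes) auto
    have Eq: "E (p \<circ> ?q) i \<longleftrightarrow> E p n" for p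
      unfolding E_def o_def block_swap_apply by simp
    have "?f (p \<circ> ?q) = ?f p" if "p \<in> ?P" for p
    proof -
      have "sign (p \<circ> ?q) = sign p"
        using that q by (subst sign_compose) (auto simp: sign_block_swap intro: permutation_permutes[THEN iffD2])
      moreover have "(\<Prod>m<Suc n. A ((p \<circ> ?q) (2 * m)) ((p \<circ> ?q) (2 * m + 1)))
          = (\<Prod>m<Suc n. A (p (2 * m)) (p (2 * m + 1)))"
        unfolding o_def block_swap_apply using i
        by (intro prod.reindex_bij_betw[where h = "Transposition.transpose i n" and g = "\<lambda>m. A (p (2 * m)) (p (2 * m + 1))"])
           (auto intro!: permutes_imp_bij permutes_swap_id)
      ultimately show ?thesis by simp
    qed
    then show ?thesis
      unfolding sum_permutations_compose_right[OF q, of "\<lambda>p. if E p i then ?f p else 0"] Eq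
      by (intro sum.cong refl) simp
  qed
  let ?Q = "{p. p permutes {..<2 * n}}"
  let ?g = "\<lambda>p. of_int (sign p) * (\<Prod>i<n. A (p (2 * i)) (p (2 * i + 1)))"
  let ?F = "\<lambda>p. p ?a = ?a \<and> p ?b = ?b"
  have F_iff: "p \<in> ?P \<and> ?F p \<longleftrightarrow> p \<in> ?Q" for p
  proof
    assume p: "p \<in> ?P \<and> ?F p"
    then have "p permutes {..<2 * Suc n}" by simp
    moreover have "p x = x" if "x \<in> {..<2 * Suc n} - {..<2 * n}" for x
    proof -
      from that have "x = ?a \<or> x = ?b" by auto
      then show ?thesis using p by auto
    qed
    ultimately have "p permutes {..<2 * n}"
      by (rule permutes_superset)
    then show "p \<in> ?Q" by simp
  next
    assume p: "p \<in> ?Q"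
    then have "p permutes {..<2 * Suc n}" by (auto intro: permutes_subset)
    with p show "p \<in> ?P \<and> ?F p" by (auto intro: permutes_not_in)
  qed
  have "(\<Sum>p\<in>?P. if ?F p then ?f p else 0) = (\<Sum>p\<in>{p \<in> ?P. ?F p}. ?f p)"
    by (simp only: sum.inter_filter[OF fin])
  also have "{p \<in> ?P. ?F p} = ?Q" using F_iff by blast
  also have "(\<Sum>p\<in>?Q. ?f p) = (\<Sum>p\<in>?Q. r * ?g p)"
  proof (rule sum.cong[OF refl])
    fix p assume "p \<in> ?Q"
    then have "?F p" using F_iff by blast
    then show "?f p = r * ?g p" using s by simp
  qed
  finally have F_sum: "(\<Sum>p\<in>?P. if ?F p then ?f p else 0) = r * sum ?g ?Q"
    by (simp only: sum_distrib_left)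
  let ?t = "Transposition.transpose ?a ?b"
  have t: "?t permutes {..<2 * Suc n}" by (intro permutes_swap_id) auto
  have E_n: "E p n \<longleftrightarrow> ?F p \<or> ?F (p \<circ> ?t)" for p
    unfolding E_def by (auto simp: doubleton_eq_iff)
  have "?f (p \<circ> ?t) = ?f p" if "p \<in> ?P" "?F p" for p
  proof -
    have "sign (p \<circ> ?t) = - sign p"
      using that t by (subst sign_compose) (auto simp: sign_swap_id intro: permutation_permutes[THEN iffD2])
    moreover have "(\<Prod>m<n. A ((p \<circ> ?t) (2 * m)) ((p \<circ> ?t) (2 * m + 1)))
          = (\<Prod>m<n. A (p (2 * m)) (p (2 * m + 1)))"
      by (intro prod.cong refl) (auto simp: Transposition.transpose_def)
    ultimately show ?thesis using that s by simp
  qed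
  then have flip: "(if ?F p then ?f (p \<circ> ?t) else 0) = (if ?F p then ?f p else 0)" if "p \<in> ?P" for p
    using that by simp
  have "(\<Sum>p\<in>?P. if E p n then ?f p else 0)
      = (\<Sum>p\<in>?P. (if ?F p then ?f p else 0) + (if ?F (p \<circ> ?t) then ?f p else 0))"
    by (intro sum.cong refl) (auto simp: E_n)
  also have "\<dots> = (\<Sum>p\<in>?P. if ?F p then ?f p else 0) + (\<Sum>p\<in>?P. if ?F (p \<circ> ?t) then ?f p else 0)"
    by (rule sum.distrib)
  also have "(\<Sum>p\<in>?P. if ?F (p \<circ> ?t) then ?f p else 0) = (\<Sum>p\<in>?P. if ?F p then ?f p else 0)"
    unfolding sum_permutations_compose_right[OF t, of "\<lambda>p. if ?F (p \<circ> ?t) then ?f p else 0"]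
    by (intro sum.cong refl, subst flip[symmetric]) (simp_all add: comp_assoc)
  finally have "(\<Sum>p\<in>?P. if E p n then ?f p else 0) = 2 * (r * sum ?g ?Q)"
    unfolding F_sum by simp
  moreover have "sum ?f ?P = (\<Sum>p\<in>?P. \<Sum>i<Suc n. if E p i then ?f p else 0)"
    by (intro sum.cong refl E_split)
  moreover have "\<dots> = (\<Sum>i<Suc n. \<Sum>p\<in>?P. if E p i then ?f p else 0)"
    by (rule sum.swap)
  moreover have "\<dots> = (\<Sum>i<Suc n. \<Sum>p\<in>?P. if E p n then ?f p else 0)"
    by (intro sum.cong refl E_move) simp
  ultimately have "sum ?f ?P = of_nat (Suc n) * (2 * (r * sum ?g ?Q))"
    by simp
  then have "pfaffian (Suc n) A = of_nat (Suc n) * (2 * (r * sum ?g ?Q)) / (2 ^ Suc n * fact (Suc n))"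
    unfolding pfaffian_def by (simp only:)
  also have "\<dots> = r * (sum ?g ?Q / (2 ^ n * fact n))"
    by (simp add: field_simps del: of_nat_Suc)
  finally show ?thesis
    by (simp only: pfaffian_def)
qed

lemma pfaffian_noninjective:
  assumes "i < 2 * n" "j < 2 * n" "i \<noteq> j" "f i = f j"
  shows "pfaffian n (\<lambda>p q. A (f p) (f q)) = 0"
  using assms by (intro pfaffian_equal_rows[of i n j]) auto

text \<open>
  By linearity in the two rows of the last block, first with row \<open>2 * n\<close> replaced by the symplectic unit
  (\<open>U\<close>), then with row \<open>2 * n + 1\<close> replaced as well (\<open>V\<close>). What is left over in the second step
  (\<open>W\<close>) has a zero row.
\<close>

lemma pfaffian_Suc_diagonal_block:
  assumes off: "\<And>p q. \<not> ({p, q} = {2 * n, 2 * n + 1}) \<Longrightarrow> B p q = A p q"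
    and B: "B (2 * n) (2 * n + 1) = A (2 * n) (2 * n + 1) + c"
           "B (2 * n + 1) (2 * n) = A (2 * n + 1) (2 * n) - c"
  shows "pfaffian (Suc n) B = pfaffian (Suc n) A + c * pfaffian n A"
proof -
  let ?a = "2 * n" and ?b = "2 * n + 1"
  define J where "J p q = (if p = ?a \<and> q = ?b then 1 else if p = ?b \<and> q = ?a then - 1 else 0 :: complex)" for p q
  define U where "U p q = (if p = ?a \<or> q = ?a then J p q else A p q)" for p q
  define V where "V p q = (if p = ?b \<or> q = ?b then J p q else U p q)" for p q
  define W where "W p q = (if {p, q} = {?a, ?b} then 0 else U p q)" for p q
  have "pfaffian (Suc n) B = 1 * pfaffian (Suc n) A + c * pfaffian (Suc n) U"
    by (rule pfaffian_linear[of ?a]) (auto simp: U_def J_def off B[simplified] doubleton_eq_iff)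
  also have "pfaffian (Suc n) U = 1 * pfaffian (Suc n) V + 1 * pfaffian (Suc n) W"
    by (rule pfaffian_linear[of ?b]) (auto simp: U_def V_def W_def J_def doubleton_eq_iff)
  also have "pfaffian (Suc n) W = 0"
    by (rule pfaffian_zero_row[of ?a]) (auto simp: U_def W_def J_def doubleton_eq_iff)
  also have "pfaffian (Suc n) V = 1 * pfaffian n V"
    by (rule pfaffian_direct_sum) (auto simp: U_def V_def J_def)
  also have "pfaffian n V = pfaffian n A"
    by (rule pfaffian_cong) (auto simp: U_def V_def)
  finally show ?thesis by simp
qed

text \<open>
  The difference is a multiple of a Pfaffian in which the indices \<open>k\<close> and \<open>a\<close> carry the same row.
\<close>

lemma pfaffian_add_row:
  assumes k: "k < 2 * n" and a: "a < 2 * n" "a \<noteq> k"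
    and off: "\<And>p q. p \<noteq> k \<Longrightarrow> q \<noteq> k \<Longrightarrow> B p q = A p q"
    and row: "\<And>q. q \<noteq> k \<Longrightarrow> B k q = A k q + c * A a q"
    and col: "\<And>q. q \<noteq> k \<Longrightarrow> B q k = A q k + c * A q a"
  shows "pfaffian n B = pfaffian n A"
proof -
  let ?D = "\<lambda>p q. A (if p = k then a else p) (if q = k then a else q)"
  have "pfaffian n B = 1 * pfaffian n A + c * pfaffian n ?D"
    using k by (rule pfaffian_linear) (auto simp: off row col)
  also have "pfaffian n ?D = 0"
    using k a by (intro pfaffian_noninjective[of k n a]) auto
  finally show ?thesis by simp
qed

text \<open>
  Read \<open>A p q\<close> as an alternating form evaluated at vectors \<open>v\<^sub>p\<close> and \<open>v\<^sub>q\<close>. Adding multiples of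
  \<open>v\<^sub>a\<close> and \<open>v\<^sub>b\<close> to the vectors before them, where \<open>a\<close> and \<open>b\<close> are the last two indices, makes those
  vectors orthogonal to \<open>v\<^sub>a\<close> and \<open>v\<^sub>b\<close> without changing the Pfaffian. The matrix is then a direct sum
  with the Schur complement as its first summand.
\<close>

lemma pfaffian_Schur_complement_total:
  assumes anti: "\<And>p q. A q p = - A p q"
    and r: "A (2 * n) (2 * n + 1) = r" "r \<noteq> 0"
  shows "pfaffian (Suc n) A = r * pfaffian n
    (\<lambda>p q. A p q + (A p (2 * n) * A (2 * n + 1) q - A p (2 * n + 1) * A (2 * n) q) / r)"
proof -
  define a b where "a = 2 * n" and "b = 2 * n + 1"
  have lt: "m < 2 * n \<Longrightarrow> m \<noteq> a \<and> m \<noteq> b \<and> m < a \<and> m < b" for m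
    by (auto simp: a_def b_def)
  have ab: "A a b = r" using r by (simp add: a_def b_def)
  define \<alpha> where "\<alpha> m p = (if p < m then - A p b / r else 0)" for m p
  define \<beta> where "\<beta> m p = (if p < m then A p a / r else 0)" for m p
  \<comment> \<open>The matrix after the first \<open>m\<close> vectors have been replaced by \<open>v\<^sub>p + \<alpha> v\<^sub>a + \<beta> v\<^sub>b\<close>.\<close>
  define G where "G m p q = A p q + \<alpha> m p * A a q + \<beta> m p * A b q + \<alpha> m q * A p a + \<beta> m q * A p b
     + (\<alpha> m p * \<beta> m q - \<beta> m p * \<alpha> m q) * r" for m p q
  have diag: "A p p = 0" for p using anti[of p p] by simp
  have ba: "A b a = - r" using anti[of b a] ab by simp
  have step: "pfaffian (Suc n) (G (Suc m)) = pfaffian (Suc n) (G m)" if "m < 2 * n" for m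
  proof -
    \<comment> \<open>Only the multiple of \<open>v\<^sub>a\<close> has been added to vector \<open>m\<close>; that of \<open>v\<^sub>b\<close> follows.\<close>
    define H where "H p q = G m p q + (if p = m then \<alpha> (Suc m) m * G m a q else 0)
      + (if q = m then \<alpha> (Suc m) m * G m p a else 0)" for p q
    have val: "\<alpha> m m = 0" "\<beta> m m = 0" "\<alpha> m a = 0" "\<beta> m a = 0" "\<alpha> m b = 0" "\<beta> m b = 0"
      using lt[OF that] by (auto simp: \<alpha>_def \<beta>_def)
    have Suc_ne: "\<alpha> (Suc m) p = \<alpha> m p" "\<beta> (Suc m) p = \<beta> m p" if "p \<noteq> m" for p
      using that by (auto simp: \<alpha>_def \<beta>_def less_Suc_eq)
    have "a < 2 * Suc n" by (simp add: a_def)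
    then have "pfaffian (Suc n) H = pfaffian (Suc n) (G m)"
      using that lt[OF that] by (intro pfaffian_add_row[of m "Suc n" a]) (auto simp: H_def)
    moreover have "pfaffian (Suc n) (G (Suc m)) = pfaffian (Suc n) H"
    proof (rule pfaffian_add_row[of m "Suc n" b _ _ "\<beta> (Suc m) m"])
      show "G (Suc m) p q = H p q" if "p \<noteq> m" "q \<noteq> m" for p q
        using that by (simp add: H_def G_def Suc_ne)
      show "G (Suc m) m q = H m q + \<beta> (Suc m) m * H b q" if "q \<noteq> m" for q
        using that lt[OF \<open>m < 2 * n\<close>] by (simp add: H_def G_def Suc_ne val algebra_simps diag ab ba)
      show "G (Suc m) q m = H q m + \<beta> (Suc m) m * H q b" if "q \<noteq> m" for q
        using that lt[OF \<open>m < 2 * n\<close>] by (simp add: H_def G_def Suc_ne val algebra_simps diag ab ba)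
    qed (use that in \<open>auto simp: b_def\<close>)
    ultimately show ?thesis by simp
  qed
  have "pfaffian (Suc n) (G m) = pfaffian (Suc n) A" if "m \<le> 2 * n" for m
    using that
  proof (induction m)
    case 0
    show ?case by (rule pfaffian_cong) (simp add: G_def \<alpha>_def \<beta>_def)
  next
    case (Suc m)
    then show ?case using step[of m] by simp
  qed
  from this[of "2 * n"] have "pfaffian (Suc n) A = pfaffian (Suc n) (G (2 * n))" by simp
  also have "\<dots> = r * pfaffian n (G (2 * n))"
  proof -
    have ge: "\<not> a < 2 * n" "\<not> b < 2 * n" by (simp_all add: a_def b_def)
    have "G (2 * n) a b = r" "G (2 * n) b a = - r"
      by (simp_all add: G_def \<alpha>_def \<beta>_def ge ab ba)
    moreover have "G (2 * n) q a = 0" "G (2 * n) a q = 0" if "q < 2 * n" for q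
      using that r(2) anti[of q a] anti[of q b]
      by (simp_all add: G_def \<alpha>_def \<beta>_def ge ab ba diag)
    ultimately show ?thesis
      unfolding a_def b_def by (intro pfaffian_direct_sum) auto
  qed
  also have "pfaffian n (G (2 * n)) = pfaffian n
    (\<lambda>p q. A p q + (A p a * A b q - A p b * A a q) / r)"
  proof (rule pfaffian_cong)
    fix p q assume "p < 2 * n" "q < 2 * n"
    then show "G (2 * n) p q = A p q + (A p a * A b q - A p b * A a q) / r"
      using r(2) anti[of a q] anti[of b q] by (simp add: G_def \<alpha>_def \<beta>_def field_simps)
  qed
  finally show ?thesis unfolding a_def b_def .
qed

text \<open>
  Antisymmetry matters only for the entries that occur in the Pfaffian.
\<close>

lemma pfaffian_Schur_complement:
  assumes anti: "\<And>p q. p < 2 * Suc n \<Longrightarrow> q < 2 * Suc n \<Longrightarrow> A q p = - A p q"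
    and r: "A (2 * n) (2 * n + 1) = r" "r \<noteq> 0"
  shows "pfaffian (Suc n) A = r * pfaffian n
    (\<lambda>p q. A p q + (A p (2 * n) * A (2 * n + 1) q - A p (2 * n + 1) * A (2 * n) q) / r)"
proof -
  define A' where "A' p q = (if p < 2 * Suc n \<and> q < 2 * Suc n then A p q else 0)" for p q
  have "pfaffian (Suc n) A = pfaffian (Suc n) A'"
    by (rule pfaffian_cong) (simp add: A'_def)
  also have "\<dots> = r * pfaffian n
      (\<lambda>p q. A' p q + (A' p (2 * n) * A' (2 * n + 1) q - A' p (2 * n + 1) * A' (2 * n) q) / r)"
  proof (rule pfaffian_Schur_complement_total)
    show "A' q p = - A' p q" for p q
      using anti[of p q] by (simp add: A'_def)
  qed (simp_all add: A'_def r[simplified])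
  also have "pfaffian n
      (\<lambda>p q. A' p q + (A' p (2 * n) * A' (2 * n + 1) q - A' p (2 * n + 1) * A' (2 * n) q) / r)
    = pfaffian n (\<lambda>p q. A p q + (A p (2 * n) * A (2 * n + 1) q - A p (2 * n + 1) * A (2 * n) q) / r)"
    by (rule pfaffian_cong) (simp add: A'_def)
  finally show ?thesis .
qed

section \<open>Positive semidefinite forms and quasifree forms\<close>

definition other_copy :: "'x \<times> bool \<Rightarrow> 'x \<times> bool" where
  "other_copy u = (fst u, \<not> snd u)"

lemma other_copy_simps [simp]:
  "other_copy (y, t) = (y, \<not> t)" "fst (other_copy u) = fst u" "other_copy (other_copy u) = u"
  by (simp_all add: other_copy_def)

text \<open>
  Hermitian forms that are positive semidefinite on finitely supported vectors, given by their matrix.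
\<close>

definition pos_form :: "('a \<Rightarrow> 'a \<Rightarrow> complex) \<Rightarrow> bool" where
  "pos_form s \<longleftrightarrow> (\<forall>u v. s v u = cnj (s u v)) \<and>
     (\<forall>F w. finite F \<longrightarrow> 0 \<le> Re (\<Sum>u\<in>F. \<Sum>v\<in>F. cnj (w u) * s u v * w v))"

lemma pos_formD:
  assumes "pos_form s"
  shows "s v u = cnj (s u v)"
    and "finite F \<Longrightarrow> 0 \<le> Re (\<Sum>u\<in>F. \<Sum>v\<in>F. cnj (w u) * s u v * w v)"
  using assms unfolding pos_form_def by blast+

lemma pos_form_diag:
  assumes "pos_form s"
  shows "s b b = of_real (Re (s b b))" "0 \<le> Re (s b b)"
proof -
  have "cnj (s b b) = s b b" using pos_formD(1)[OF assms, of b b] by simp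
  then show "s b b = of_real (Re (s b b))" by (metis Reals_cnj_iff of_real_Re)
  show "0 \<le> Re (s b b)" using pos_formD(2)[OF assms, of "{b}" "\<lambda>_. 1"] by simp
qed

text \<open>
  The value of the form at \<open>e\<^sub>u - r * s b u * e\<^sub>b\<close> decreases linearly in \<open>r\<close> with slope
  proportional to \<open>(cmod (s b u))\<^sup>2\<close>, yet it is nonnegative for all \<open>r\<close>.
\<close>

lemma pos_form_zero_row:
  assumes s: "pos_form s" and b: "s b b = 0"
  shows "s b u = 0"
proof (cases "u = b")
  case False
  define z where "z = s b u"
  have ub: "s u b = cnj z" unfolding z_def by (rule pos_formD(1)[OF s])
  have "0 \<le> Re (s u u) - 2 * r * (cmod z)\<^sup>2" for r :: real
  proof -
    define w where "w v = (if v = b then - of_real r * z else 1)" for v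
    have "0 \<le> Re (\<Sum>p\<in>{b, u}. \<Sum>v\<in>{b, u}. cnj (w p) * s p v * w v)"
      by (rule pos_formD(2)[OF s]) simp
    also have "\<dots> = Re (s u u) - 2 * r * (cmod z)\<^sup>2"
      using False unfolding cmod_power2
      by (simp add: w_def b ub z_def[symmetric] power2_eq_square algebra_simps)
    finally show ?thesis .
  qed
  \<comment> \<open>For \<open>z \<noteq> 0\<close>, the value of the form would be \<open>- 1\<close> at this \<open>r\<close>.\<close>
  from this[of "(Re (s u u) + 1) / (2 * (cmod z)\<^sup>2)"] show ?thesis
    by (cases "z = 0") (auto simp: z_def)
qed (simp add: b)

lemma pos_form_rank_one:
  assumes "0 \<le> r" "\<And>v. f v = cnj (g v)"
  shows "pos_form (\<lambda>u v. of_real r * (f u * g v))"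
  unfolding pos_form_def
proof (intro conjI allI impI)
  show "complex_of_real r * (f v * g u) = cnj (complex_of_real r * (f u * g v))" for u v
    by (simp add: assms mult.commute)
next
  fix F and w :: "'a \<Rightarrow> complex"
  define L where "L = (\<Sum>v\<in>F. g v * w v)"
  have "cnj L = (\<Sum>u\<in>F. cnj (w u) * f u)"
    unfolding L_def cnj_sum by (intro sum.cong refl) (simp add: assms(2) mult.commute)
  then have "(\<Sum>u\<in>F. \<Sum>v\<in>F. cnj (w u) * (of_real r * (f u * g v)) * w v) = of_real r * (cnj L * L)"
    by (simp add: L_def sum_product sum_distrib_left mult_ac)
  also have "cnj L * L = of_real ((cmod L)\<^sup>2)"
    by (simp only: complex_norm_square mult.commute)
  finally show "0 \<le> Re (\<Sum>u\<in>F. \<Sum>v\<in>F. cnj (w u) * (of_real r * (f u * g v)) * w v)"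
    using assms(1) by simp
qed

lemma pos_form_add:
  assumes "pos_form s" "pos_form t"
  shows "pos_form (\<lambda>u v. s u v + t u v)"
  unfolding pos_form_def
proof (intro conjI allI impI)
  show "s v u + t v u = cnj (s u v + t u v)" for u v
    using pos_formD(1)[OF assms(1), of v u] pos_formD(1)[OF assms(2), of v u] by simp
  fix F :: "'a set" and w :: "'a \<Rightarrow> complex" assume "finite F"
  then show "0 \<le> Re (\<Sum>u\<in>F. \<Sum>v\<in>F. cnj (w u) * (s u v + t u v) * w v)"
    using pos_formD(2)[OF assms(1), of F w] pos_formD(2)[OF assms(2), of F w]
    by (simp add: algebra_simps sum.distrib)
qed

text \<open>
  Its value at \<open>w\<close> is the value of \<open>s\<close> at \<open>w - (L / s b b) * e\<^sub>b\<close>, where \<open>L\<close> is the pairing of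
  \<open>e\<^sub>b\<close> with \<open>w\<close>.
\<close>

lemma pos_form_Schur:
  assumes s: "pos_form s" and b: "s b b \<noteq> 0"
  shows "pos_form (\<lambda>u v. s u v - s u b * s b v / s b b)"
  unfolding pos_form_def
proof (intro conjI allI impI)
  define r where "r = Re (s b b)"
  have bb: "s b b = of_real r" and r: "r \<noteq> 0" "0 \<le> r"
    using pos_form_diag[OF s, of b] b unfolding r_def by auto
  have herm: "s v u = cnj (s u v)" for u v by (rule pos_formD(1)[OF s])
  show "s v u - s v b * s b u / s b b = cnj (s u v - s u b * s b v / s b b)" for u v
    using herm[of u v] herm[of u b] herm[of v b] unfolding bb by simp
  fix F :: "'a set" and w :: "'a \<Rightarrow> complex" assume F: "finite F"
  \<comment> \<open>Extend \<open>w\<close> by zero, so that \<open>b\<close> may be assumed to be in the range of summation.\<close>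
  define w0 where "w0 v = (if v \<in> F then w v else 0)" for v
  define G where "G = insert b F"
  have G: "finite G" "F \<subseteq> G" "b \<in> G" using F by (auto simp: G_def)
  define L where "L = (\<Sum>v\<in>G. s b v * w0 v)"
  define Q where "Q = (\<Sum>u\<in>G. \<Sum>v\<in>G. cnj (w0 u) * s u v * w0 v)"
  have cL: "cnj L = (\<Sum>u\<in>G. cnj (w0 u) * s u b)"
    unfolding L_def cnj_sum by (intro sum.cong refl) (simp add: herm[symmetric] mult.commute)
  define w1 where "w1 v = w0 v - (if v = b then L / of_real r else 0)" for v
  have "(\<Sum>u\<in>G. \<Sum>v\<in>G. cnj (w1 u) * s u v * w1 v)
     = (\<Sum>u\<in>G. cnj (w1 u) * ((\<Sum>v\<in>G. s u v * w0 v) - s u b * (L / of_real r)))"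
  proof (intro sum.cong refl)
    fix u
    have "(\<Sum>v\<in>G. cnj (w1 u) * s u v * w1 v)
      = (\<Sum>v\<in>G. cnj (w1 u) * (s u v * w0 v) - (if v = b then cnj (w1 u) * (s u b * (L / of_real r)) else 0))"
      by (intro sum.cong refl) (auto simp: w1_def algebra_simps)
    then show "(\<Sum>v\<in>G. cnj (w1 u) * s u v * w1 v)
      = cnj (w1 u) * ((\<Sum>v\<in>G. s u v * w0 v) - s u b * (L / of_real r))"
      using G by (simp add: sum_subtractf sum_distrib_left right_diff_distrib)
  qed
  also have "\<dots> = (\<Sum>u\<in>G. cnj (w0 u) * ((\<Sum>v\<in>G. s u v * w0 v) - s u b * (L / of_real r))
      - (if u = b then cnj (L / of_real r) * (L - s b b * (L / of_real r)) else 0))"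
    by (intro sum.cong refl) (auto simp: w1_def L_def left_diff_distrib)
  also have "\<dots> = (\<Sum>u\<in>G. cnj (w0 u) * ((\<Sum>v\<in>G. s u v * w0 v) - s u b * (L / of_real r)))"
    using G r by (simp add: sum_subtractf bb)
  also have "\<dots> = Q - cnj L * (L / of_real r)"
    unfolding Q_def cL sum_distrib_right right_diff_distrib sum_subtractf
    by (simp add: sum_distrib_left mult.assoc)
  also have "\<dots> = (\<Sum>u\<in>G. \<Sum>v\<in>G. cnj (w0 u) * (s u v - s u b * s b v / s b b) * w0 v)"
  proof -
    have "cnj L * (L / of_real r) = (\<Sum>u\<in>G. \<Sum>v\<in>G. cnj (w0 u) * (s u b * s b v / s b b) * w0 v)"
      unfolding cL by (simp add: L_def sum_divide_distrib sum_product bb mult_ac)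
    then show ?thesis
      unfolding Q_def by (simp add: sum_subtractf algebra_simps)
  qed
  also have "\<dots> = (\<Sum>u\<in>G. \<Sum>v\<in>F. cnj (w0 u) * (s u v - s u b * s b v / s b b) * w0 v)"
    using G by (intro sum.cong refl sum.mono_neutral_right) (auto simp: w0_def)
  also have "\<dots> = (\<Sum>u\<in>F. \<Sum>v\<in>F. cnj (w0 u) * (s u v - s u b * s b v / s b b) * w0 v)"
    using G by (intro sum.mono_neutral_right) (auto simp: w0_def)
  also have "\<dots> = (\<Sum>u\<in>F. \<Sum>v\<in>F. cnj (w u) * (s u v - s u b * s b v / s b b) * w v)"
    by (intro sum.cong refl) (auto simp: w0_def)
  finally show "0 \<le> Re (\<Sum>u\<in>F. \<Sum>v\<in>F. cnj (w u) * (s u v - s u b * s b v / s b b) * w v)"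
    using pos_formD(2)[OF s G(1), of w1] by simp
qed

lemma pos_form_reindex:
  assumes s: "pos_form s" and h: "inj h"
  shows "pos_form (\<lambda>u v. s (h u) (h v))"
  unfolding pos_form_def
proof (intro conjI allI impI)
  show "s (h v) (h u) = cnj (s (h u) (h v))" for u v by (rule pos_formD(1)[OF s])
  fix F :: "'b set" and w :: "'b \<Rightarrow> complex" assume F: "finite F"
  have inj: "inj_on h F" using h by (rule inj_on_subset) simp
  have "0 \<le> Re (\<Sum>u\<in>h ` F. \<Sum>v\<in>h ` F. cnj (w (inv h u)) * s u v * w (inv h v))"
    using F by (intro pos_formD(2)[OF s]) simp
  then show "0 \<le> Re (\<Sum>u\<in>F. \<Sum>v\<in>F. cnj (w u) * s (h u) (h v) * w v)"
    by (simp only: sum.reindex[OF inj] o_def inv_f_f[OF h])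
qed

text \<open>
  The matrix form of \<open>0 \<le> S = S\<^sup>*\<close> and \<open>\<Gamma> S \<Gamma> = 1 - S\<close>, the latter only between basis vectors over
  points of \<open>X\<close>, because conditioning on a particle destroys it at the point of that particle. It
  turns the lower bound on \<open>S\<close> over these points into the upper bound.
\<close>

definition quasifree :: "'x set \<Rightarrow> ('x \<times> bool \<Rightarrow> 'x \<times> bool \<Rightarrow> complex) \<Rightarrow> bool" where
  "quasifree X s \<longleftrightarrow> pos_form s \<and>
     (\<forall>u v. fst u \<in> X \<longrightarrow> fst v \<in> X \<longrightarrow> s (other_copy v) (other_copy u) = of_bool (u = v) - s u v)"

lemma quasifreeD:
  assumes "quasifree X s"
  shows "pos_form s"
    and "fst u \<in> X \<Longrightarrow> fst v \<in> X \<Longrightarrow> s (other_copy v) (other_copy u) = of_bool (u = v) - s u v"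
  using assms unfolding quasifree_def by blast+

text \<open>
  The entries of the kernel: the rows of \<open>s\<close> with the two copies exchanged, minus the unit that turns
  \<open>S\<^sub>1\<^sub>1\<close> into \<open>S\<^sub>1\<^sub>1 - 1\<close>.
\<close>

definition pairing :: "('x \<times> bool \<Rightarrow> 'x \<times> bool \<Rightarrow> complex) \<Rightarrow> 'x \<times> bool \<Rightarrow> 'x \<times> bool \<Rightarrow> complex" where
  "pairing s u v = s (other_copy u) v - of_bool (other_copy u = v \<and> snd u)"

text \<open>
  Duality makes the contributions of \<open>s\<close> to the two entries add up to the unit of exchanged copies, and
  the unit subtracted in \<open>pairing\<close> does so as well.
\<close>

lemma pairing_antisym:
  assumes "quasifree X s" "fst u \<in> X" "fst v \<in> X"
  shows "pairing s v u = - pairing s u v"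
  using quasifreeD(2)[OF assms(1), of "other_copy u" v] assms(2,3)
  unfolding pairing_def by (cases u; cases v) auto

text \<open>
  The basis vector that belongs to a matrix index: the points own two consecutive indices each, the
  even one for the first copy.
\<close>

definition doubled :: "(nat \<Rightarrow> 'x) \<Rightarrow> nat \<Rightarrow> 'x \<times> bool" where
  "doubled x p = (x (p div 2), odd p)"

definition pairing_matrix ::
    "('x \<times> bool \<Rightarrow> 'x \<times> bool \<Rightarrow> complex) \<Rightarrow> (nat \<Rightarrow> 'x) \<Rightarrow> nat \<Rightarrow> nat \<Rightarrow> complex" where
  "pairing_matrix s x p q = pairing s (doubled x p) (doubled x q)"

text \<open>
  The quasifree form of the process conditioned on a particle at \<open>y\<close>. It is the Schur complement of
  \<open>S - P\<close>, with \<open>P\<close> the projection onto the first copy at \<open>y\<close>: by duality, the \<open>y\<close> block of this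
  operator is diagonal with entries \<open>- r\<close> and \<open>r\<close>, where \<open>r = s (y, True) (y, True)\<close>.
\<close>

definition condition ::
    "'x \<Rightarrow> ('x \<times> bool \<Rightarrow> 'x \<times> bool \<Rightarrow> complex) \<Rightarrow> 'x \<times> bool \<Rightarrow> 'x \<times> bool \<Rightarrow> complex" where
  "condition y s u v = s u v
     + (s u (y, False) * s (y, False) v - s u (y, True) * s (y, True) v) / s (y, True) (y, True)"

text \<open>
  The term of \<open>(y, True)\<close> gives a Schur complement of the positive form \<open>s\<close>, and the term of \<open>(y, False)\<close>
  adds a positive form of rank one. Exchanging the copies maps the two terms to each other with
  opposite sign, which is what duality requires of a correction to \<open>s\<close>.
\<close>

lemma quasifree_condition:
  assumes s: "quasifree (insert y X) s" and y: "y \<notin> X" and r: "s (y, True) (y, True) \<noteq> 0"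
  shows "quasifree X (condition y s)"
proof -
  let ?a = "(y, False)" and ?b = "(y, True)"
  note pos = quasifreeD(1)[OF s]
  note herm = pos_formD(1)[OF pos]
  define t where "t = 1 / Re (s ?b ?b)"
  have bb: "s ?b ?b = of_real (Re (s ?b ?b))" "0 \<le> Re (s ?b ?b)"
    by (rule pos_form_diag[OF pos])+
  have t: "1 / s ?b ?b = of_real t" "0 \<le> t"
    using bb unfolding t_def by (metis of_real_1 of_real_divide, simp)
  have "condition y s = (\<lambda>u v. (s u v - s u ?b * s ?b v / s ?b ?b) + of_real t * (s u ?a * s ?a v))"
    unfolding condition_def t(1)[symmetric] by (simp add: fun_eq_iff diff_divide_distrib)
  moreover have "pos_form (\<lambda>u v. (s u v - s u ?b * s ?b v / s ?b ?b) + of_real t * (s u ?a * s ?a v))"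
    by (intro pos_form_add pos_form_Schur pos_form_rank_one pos r t herm)
  ultimately have "pos_form (condition y s)" by simp
  moreover have "condition y s (other_copy v) (other_copy u) = of_bool (u = v) - condition y s u v"
    if "fst u \<in> X" "fst v \<in> X" for u v
  proof -
    have ne: "u \<noteq> ?a" "u \<noteq> ?b" "v \<noteq> ?a" "v \<noteq> ?b" using that y by auto
    have "s (other_copy v) ?b = - s ?a v" "s (other_copy v) ?a = - s ?b v"
         "s ?b (other_copy u) = - s u ?a" "s ?a (other_copy u) = - s u ?b"
      using quasifreeD(2)[OF s, of ?a v] quasifreeD(2)[OF s, of ?b v]
        quasifreeD(2)[OF s, of u ?a] quasifreeD(2)[OF s, of u ?b] that ne by auto
    moreover have "s (other_copy v) (other_copy u) = of_bool (u = v) - s u v"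
      using that by (intro quasifreeD(2)[OF s]) auto
    ultimately show ?thesis
      unfolding condition_def by (simp add: diff_divide_distrib mult.commute)
  qed
  ultimately show ?thesis by (simp add: quasifree_def)
qed

text \<open>
  Remove the last point \<open>y\<close>. The Schur complement of its block is the matrix of the form conditioned at
  \<open>y\<close>, so the induction hypothesis applies to it; the pivot \<open>s (y, True) (y, True)\<close> is nonnegative, and
  if it vanishes, then so does a row of the matrix.
\<close>

lemma pfaffian_pairing_nonneg:
  assumes "inj_on x {..<n}" "quasifree (x ` {..<n}) s"
  shows "pfaffian n (pairing_matrix s x) \<in> \<real>\<^sub>\<ge>\<^sub>0"
  using assms
proof (induction n arbitrary: s)
  case 0
  then show ?case by (simp add: pfaffian_def)
next
  case (Suc n)
  let ?y = "x n" and ?A = "pairing_matrix s x"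
  let ?a = "(?y, False)" and ?b = "(?y, True)"
  have X: "x ` {..<Suc n} = insert ?y (x ` {..<n})" by (simp add: lessThan_Suc)
  have inj: "inj_on x {..<n}" using Suc.prems(1) by (rule inj_on_subset) auto
  have fresh: "x i \<noteq> ?y" if "i < n" for i
    using inj_onD[OF Suc.prems(1), of i n] that by auto
  note s = Suc.prems(2)
  note pos = quasifreeD(1)[OF s]
  have anti: "?A q p = - ?A p q" if "p < 2 * Suc n" "q < 2 * Suc n" for p q
    unfolding pairing_matrix_def
    by (rule pairing_antisym[OF s]) (use that in \<open>auto simp: doubled_def intro!: imageI\<close>)
  have ab: "doubled x (2 * n) = ?a" "doubled x (2 * n + 1) = ?b"
    by (simp_all add: doubled_def)
  have r: "?A (2 * n) (2 * n + 1) = s ?b ?b"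
    unfolding pairing_matrix_def ab by (simp add: pairing_def)
  show ?case
  proof (cases "s ?b ?b = 0")
    case True
    have zero: "?A (2 * n) q = 0" for q
      unfolding pairing_matrix_def ab pairing_def by (simp add: pos_form_zero_row[OF pos True])
    define B where "B p q = (if p < 2 * Suc n \<and> q < 2 * Suc n then ?A p q else 0)" for p q
    have "pfaffian (Suc n) ?A = pfaffian (Suc n) B"
      by (rule pfaffian_cong) (simp add: B_def)
    also have "\<dots> = 0"
    proof (rule pfaffian_zero_row[of "2 * n"])
      show "B (2 * n) q = 0" "B q (2 * n) = 0" for q
        using zero anti[of "2 * n" q] by (auto simp: B_def)
    qed simp
    finally show ?thesis by simp
  next
    case False
    have "pfaffian n (pairing_matrix (condition ?y s) x) \<in> \<real>\<^sub>\<ge>\<^sub>0"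
      using s fresh False unfolding X
      by (intro Suc.IH[OF inj] quasifree_condition) (auto, metis)
    moreover have "s ?b ?b \<in> \<real>\<^sub>\<ge>\<^sub>0"
      using pos_form_diag[OF pos, of ?b] by (metis nonneg_Reals_of_real_iff)
    moreover have "pfaffian n (\<lambda>p q. ?A p q + (?A p (2 * n) * ?A (2 * n + 1) q - ?A p (2 * n + 1) * ?A (2 * n) q) / s ?b ?b)
       = pfaffian n (pairing_matrix (condition ?y s) x)"
    proof (rule pfaffian_cong)
      fix p q assume pq: "p < 2 * n" "q < 2 * n"
      then have "x (p div 2) \<noteq> ?y" "x (q div 2) \<noteq> ?y" by (auto intro!: fresh)
      then have ne: "fst (doubled x p) \<noteq> ?y" "fst (doubled x q) \<noteq> ?y" by (simp_all add: doubled_def)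
      have ne': "(other_copy u = v) = False" if "fst u \<noteq> fst v" for u v :: "'a \<times> bool"
        using that by (auto simp: other_copy_def)
      show "?A p q + (?A p (2 * n) * ?A (2 * n + 1) q - ?A p (2 * n + 1) * ?A (2 * n) q) / s ?b ?b
        = pairing_matrix (condition ?y s) x p q"
        using ne ne[symmetric] unfolding pairing_matrix_def ab pairing_def condition_def
        by (simp add: ne' del: other_copy_simps(1)) (simp add: other_copy_def)
    qed
    moreover have "pfaffian (Suc n) ?A = s ?b ?b * pfaffian n
        (\<lambda>p q. ?A p q + (?A p (2 * n) * ?A (2 * n + 1) q - ?A p (2 * n + 1) * ?A (2 * n) q) / s ?b ?b)"
      by (rule pfaffian_Schur_complement[OF anti r False])
    ultimately show ?thesis by (simp only: nonneg_Reals_mult_I)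
  qed
qed

text \<open>
  The exchange of the two copies at the points of \<open>C\<close>.
\<close>

definition flip :: "'x set \<Rightarrow> 'x \<times> bool \<Rightarrow> 'x \<times> bool" where
  "flip C u = (fst u, snd u \<noteq> (fst u \<in> C))"

definition particle_hole ::
    "'x set \<Rightarrow> ('x \<times> bool \<Rightarrow> 'x \<times> bool \<Rightarrow> complex) \<Rightarrow> 'x \<times> bool \<Rightarrow> 'x \<times> bool \<Rightarrow> complex" where
  "particle_hole C s u v = s (flip C u) (flip C v)"

lemma inj_flip: "inj (flip C)"
  by (auto simp: inj_def flip_def prod_eq_iff)

lemma quasifree_particle_hole:
  assumes "quasifree X s"
  shows "quasifree X (particle_hole C s)"
proof -
  have "particle_hole C s (other_copy v) (other_copy u) = of_bool (u = v) - particle_hole C s u v"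
    if "fst u \<in> X" "fst v \<in> X" for u v
  proof -
    have "flip C (other_copy u) = other_copy (flip C u)" "fst (flip C u) = fst u" for u
      by (auto simp: flip_def other_copy_def)
    then show ?thesis
      using quasifreeD(2)[OF assms, of "flip C u" "flip C v"] that
      by (simp only: particle_hole_def inj_eq[OF inj_flip])
  qed
  moreover have "pos_form (particle_hole C s)"
    using pos_form_reindex[OF quasifreeD(1)[OF assms] inj_flip] by (simp add: particle_hole_def[abs_def])
  ultimately show ?thesis by (simp add: quasifree_def)
qed

text \<open>
  Exchanging the last two indices of the transformed matrix changes the sign of its Pfaffian and gives
  back the original matrix, except that \<open>1\<close> has been subtracted from the entry above the diagonal in
  the last block: the unit subtracted in \<open>pairing\<close> now sits on the other side of the diagonal.
\<close>

lemma pfaffian_particle_hole: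
  assumes inj: "inj_on x {..<Suc n}"
  shows "pfaffian (Suc n) (pairing_matrix s x) + pfaffian (Suc n) (pairing_matrix (particle_hole {x n} s) x)
    = pfaffian n (pairing_matrix s x)"
proof -
  let ?a = "2 * n" and ?b = "2 * n + 1"
  let ?A = "pairing_matrix s x" and ?A' = "pairing_matrix (particle_hole {x n} s) x"
  let ?t = "Transposition.transpose ?a ?b"
  define B where "B p q = ?A p q + (if p = ?a \<and> q = ?b then - 1 else if p = ?b \<and> q = ?a then 1 else 0)" for p q
  have fresh: "x i \<noteq> x n" if "i < n" for i
    using inj_onD[OF inj, of i n] that by auto
  have t: "?t permutes {..<2 * Suc n}" by (intro permutes_swap_id) auto
  have dbl: "doubled x ?a = (x n, False)" "doubled x ?b = (x n, True)" by (simp_all add: doubled_def)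
  have "- pfaffian (Suc n) ?A' = pfaffian (Suc n) (\<lambda>p q. ?A' (?t p) (?t q))"
    unfolding pfaffian_permute[OF t] by (simp add: sign_swap_id)
  also have "\<dots> = pfaffian (Suc n) B"
  proof (rule pfaffian_cong)
    fix p q assume pq: "p < 2 * Suc n" "q < 2 * Suc n" "p \<noteq> q"
    have flip_dbl: "flip {x n} (doubled x (?t m)) = doubled x m" if "m < 2 * Suc n" for m
    proof -
      have "m = ?a \<or> m = ?b \<or> m < 2 * n" using that by presburger
      then consider "m = ?a" | "m = ?b" | "m < 2 * n" by blast
      then show ?thesis
      proof cases
        case 3
        then have "x (m div 2) \<noteq> x n" "?t m = m"
          by (auto intro!: fresh simp: Transposition.transpose_def)
        then show ?thesis by (simp add: flip_def doubled_def)
      qed (simp_all only: transpose_apply_first transpose_apply_second dbl, auto simp: flip_def)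
    qed
    have flip_oc: "flip {x n} (other_copy u) = other_copy (flip {x n} u)" for u
      by (auto simp: flip_def other_copy_def)
    let ?u = "doubled x (?t p)" and ?v = "doubled x (?t q)"
    have eq: "?A' (?t p) (?t q) = s (other_copy (doubled x p)) (doubled x q)
        - of_bool (other_copy ?u = ?v \<and> snd ?u)"
      unfolding pairing_matrix_def pairing_def particle_hole_def flip_oc
      by (simp only: flip_dbl pq)
    have "of_bool (other_copy ?u = ?v \<and> snd ?u) = of_bool (other_copy (doubled x p) = doubled x q \<and> snd (doubled x p))
      - (if p = ?a \<and> q = ?b then - 1 else if p = ?b \<and> q = ?a then 1 else 0 :: complex)"
    proof -
      have "p = ?a \<and> q = ?b \<or> p = ?b \<and> q = ?a \<or> p < 2 * n \<and> q < 2 * n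
        \<or> p < 2 * n \<and> q \<ge> 2 * n \<or> p \<ge> 2 * n \<and> q < 2 * n"
        using pq by presburger
      then consider "p = ?a" "q = ?b" | "p = ?b" "q = ?a" | "p < 2 * n" "q < 2 * n"
        | "p < 2 * n" "q \<ge> 2 * n" | "p \<ge> 2 * n" "q < 2 * n"
        by blast
      then show ?thesis
      proof cases
        case 1
        then show ?thesis by (simp only: transpose_apply_first transpose_apply_second dbl) simp
      next
        case 2
        then show ?thesis by (simp only: transpose_apply_first transpose_apply_second dbl) simp
      next
        case 3
        then have "?t p = p" "?t q = q" by (auto simp: Transposition.transpose_def)
        then show ?thesis using 3 by simp
      next
        case 4
        then have "q = ?a \<or> q = ?b" "?t p = p" "x (p div 2) \<noteq> x n"
          using pq by (auto simp: Transposition.transpose_def intro!: fresh)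
        moreover have "fst (doubled x (?t q)) = x n" "fst (doubled x q) = x n"
          using calculation(1) dbl by (auto simp: Transposition.transpose_def)
        moreover have "fst (doubled x p) = x (p div 2)" by (simp add: doubled_def)
        ultimately have "other_copy ?u \<noteq> ?v" "other_copy (doubled x p) \<noteq> doubled x q"
          by (metis other_copy_simps(2))+
        then show ?thesis using 4 by simp
      next
        case 5
        then have "p = ?a \<or> p = ?b" "?t q = q" "x (q div 2) \<noteq> x n"
          using pq by (auto simp: Transposition.transpose_def intro!: fresh)
        moreover have "fst (doubled x (?t p)) = x n" "fst (doubled x p) = x n"
          using calculation(1) dbl by (auto simp: Transposition.transpose_def)
        moreover have "fst (doubled x q) = x (q div 2)" by (simp add: doubled_def)
        ultimately have "other_copy ?u \<noteq> ?v" "other_copy (doubled x p) \<noteq> doubled x q"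
          by (metis other_copy_simps(2))+
        then show ?thesis using 5 by simp
      qed
    qed
    then show "?A' (?t p) (?t q) = B p q"
      unfolding eq B_def by (simp add: pairing_matrix_def pairing_def)
  qed
  also have "\<dots> = pfaffian (Suc n) ?A + (- 1) * pfaffian n ?A"
    by (rule pfaffian_Suc_diagonal_block) (auto simp: B_def)
  finally show ?thesis by (simp add: algebra_simps add_eq_0_iff2)
qed

section \<open>Random configurations with prescribed marginals\<close>

text \<open>
  Consistency at one additional point at a time suffices for all the weights to have the same total.
\<close>

lemma sum_marginal:
  fixes \<mu> :: "'x set \<Rightarrow> 'x set \<Rightarrow> real"
  assumes "\<And>X y A. finite X \<Longrightarrow> y \<notin> X \<Longrightarrow> A \<subseteq> X \<Longrightarrow>
    \<mu> (insert y X) A + \<mu> (insert y X) (insert y A) = \<mu> X A"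
  assumes "finite X"
  shows "sum (\<mu> X) (Pow X) = \<mu> {} {}"
  using assms(2)
proof induction
  case (insert y X)
  have "sum (\<mu> (insert y X)) (Pow (insert y X))
      = sum (\<mu> (insert y X)) (Pow X) + sum (\<mu> (insert y X)) (insert y ` Pow X)"
    unfolding Pow_insert using insert by (intro sum.union_disjoint) auto
  also have "sum (\<mu> (insert y X)) (insert y ` Pow X) = (\<Sum>A\<in>Pow X. \<mu> (insert y X) (insert y A))"
    using insert by (subst sum.reindex) (auto simp: inj_on_def)
  also have "sum (\<mu> (insert y X)) (Pow X) + \<dots> = sum (\<mu> X) (Pow X)"
    using insert assms(1) by (simp add: sum.distrib[symmetric])
  finally show ?case using insert by simp
qed simp

lemma borel_bool: "sets (borel :: bool measure) = UNIV"
proof -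
  have "open A" for A :: "bool set" by (rule discrete_topology_class.open_discrete)
  then show ?thesis by (auto simp: borel_open)
qed

text \<open>
  This makes the Borel sets of the configuration space those of the product \<open>\<sigma>\<close>-algebra.
\<close>

instance bool :: second_countable_topology
proof
  have "open = generate_topology (UNIV :: bool set set)"
    by (auto simp: fun_eq_iff discrete_topology_class.open_discrete intro: generate_topology.Basis)
  then show "\<exists>B :: bool set set. countable B \<and> open = generate_topology B"
    by (intro exI[of _ UNIV] conjI countable_finite) auto
qed

text \<open>
  Kolmogorov's extension theorem for configurations. The weights \<open>\<mu> X\<close> are a probability distribution
  \<open>p X\<close> on the subsets of \<open>X\<close>, and consistency at one point at a time makes these distributions
  projective. Configurations are encoded as functions with values \<open>0\<close> and \<open>1\<close> in
  the Polish space of reals.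
\<close>

lemma exists_configuration_measure:
  fixes \<mu> :: "'x :: countable set \<Rightarrow> 'x set \<Rightarrow> real"
  assumes nonneg: "\<And>X A. finite X \<Longrightarrow> A \<subseteq> X \<Longrightarrow> 0 \<le> \<mu> X A"
    and total: "\<mu> {} {} = 1"
    and marginal: "\<And>X y A. finite X \<Longrightarrow> y \<notin> X \<Longrightarrow> A \<subseteq> X \<Longrightarrow>
      \<mu> (insert y X) A + \<mu> (insert y X) (insert y A) = \<mu> X A"
  shows "\<exists>M :: ('x \<Rightarrow> bool) measure. prob_space M \<and> sets M = sets borel \<and>
    (\<forall>X. finite X \<longrightarrow> measure M {\<omega>. \<forall>x\<in>X. \<omega> x} = \<mu> X X)"
proof -
  define d where "d X A = (if A \<subseteq> X then \<mu> X A else 0)" for X A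
  define p where "p X = embed_pmf (d X)" for X
  have d_nonneg: "0 \<le> d X A" if "finite X" for X A
    using nonneg that by (simp add: d_def)
  have pmf_p: "pmf (p X) A = d X A" if X: "finite X" for X A
    unfolding p_def
  proof (rule pmf_embed_pmf)
    have "(\<integral>\<^sup>+ A. ennreal (d X A) \<partial>count_space UNIV) = (\<Sum>A\<in>Pow X. ennreal (d X A))"
      using X by (intro nn_integral_count_space'[where A = "Pow X" and B = UNIV]) (auto simp: d_def)
    also have "\<dots> = ennreal (\<Sum>A\<in>Pow X. d X A)"
      by (simp add: d_nonneg[OF X])
    also have "(\<Sum>A\<in>Pow X. d X A) = sum (\<mu> X) (Pow X)"
      by (simp add: d_def)
    also have "\<dots> = 1"
      using sum_marginal[of \<mu>, OF marginal X] total by simp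
    finally show "(\<integral>\<^sup>+ A. ennreal (d X A) \<partial>count_space UNIV) = 1" by simp
  qed (rule d_nonneg[OF X])
  have p_remove: "map_pmf (\<lambda>A. A \<inter> X) (p (insert y X)) = p X" if X: "finite X" "y \<notin> X" for X y
  proof (rule pmf_eqI)
    fix B
    let ?V = "(\<lambda>A. A \<inter> X) -` {B}"
    have "pmf (map_pmf (\<lambda>A. A \<inter> X) (p (insert y X))) B = measure (p (insert y X)) ?V"
      by (simp add: pmf_map)
    also have "\<dots> = measure (p (insert y X)) (?V \<inter> set_pmf (p (insert y X)))"
      by (simp add: measure_Int_set_pmf)
    also have "\<dots> = measure (p (insert y X)) (?V \<inter> Pow (insert y X) \<inter> set_pmf (p (insert y X)))"
      using X by (intro arg_cong[where f = "measure _"]) (auto simp: set_pmf_eq pmf_p d_def)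
    also have "\<dots> = measure (p (insert y X)) (?V \<inter> Pow (insert y X))"
      by (rule measure_Int_set_pmf)
    also have "?V \<inter> Pow (insert y X) = (if B \<subseteq> X then {B, insert y B} else {})"
      using X by auto
    also have "measure (p (insert y X)) \<dots> = pmf (p X) B"
    proof (cases "B \<subseteq> X")
      case True
      with X have "B \<noteq> insert y B" by auto
      then have "measure (p (insert y X)) {B, insert y B} = d (insert y X) B + d (insert y X) (insert y B)"
        using X by (simp add: measure_measure_pmf_finite pmf_p)
      with True X marginal[OF X True] show ?thesis
        by (auto simp: pmf_p d_def)
    qed (use X in \<open>simp add: pmf_p d_def\<close>)
    finally show "pmf (map_pmf (\<lambda>A. A \<inter> X) (p (insert y X))) B = pmf (p X) B" .
  qed
  have p_restrict: "map_pmf (\<lambda>A. A \<inter> J) (p H) = p J" if "finite H" "J \<subseteq> H" for J H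
  proof -
    have "map_pmf (\<lambda>A. A \<inter> J) (p (K \<union> J)) = p J" if "finite K" "K \<inter> J = {}" "finite J" for K J
      using that
    proof (induction K)
      case empty
      have "map_pmf (\<lambda>A. A \<inter> J) (p J) = map_pmf id (p J)"
        using empty by (intro map_pmf_cong refl) (auto simp: set_pmf_eq pmf_p d_def split: if_splits)
      then show ?case by simp
    next
      case (insert y K)
      have "map_pmf (\<lambda>A. A \<inter> J) (p (insert y K \<union> J))
          = map_pmf (\<lambda>A. A \<inter> J) (map_pmf (\<lambda>A. A \<inter> (K \<union> J)) (p (insert y (K \<union> J))))"
        by (simp add: map_pmf_comp Int_assoc Int_absorb1)
      also have "map_pmf (\<lambda>A. A \<inter> (K \<union> J)) (p (insert y (K \<union> J))) = p (K \<union> J)"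
        using insert by (intro p_remove) auto
      finally show ?case using insert by auto
    qed
    from this[of "H - J" J] that show ?thesis
      by (simp add: finite_subset Un_absorb2 Diff_Int_distrib2)
  qed
  define enc where "enc J A = (\<lambda>i\<in>J. of_bool (i \<in> A) :: real)" for J :: "'x set" and A :: "'x set"
  define P where "P J = distr (measure_pmf (p J)) (PiM J (\<lambda>_. borel :: real measure)) (enc J)" for J
  have enc: "enc J \<in> measurable (measure_pmf q) (PiM J (\<lambda>_. borel :: real measure))" for J q
    by (auto simp: enc_def space_PiM PiE_def)
  interpret L: polish_projective UNIV P
  proof (intro polish_projective.intro projective_family.intro)
    fix J H :: "'x set" assume JH: "J \<subseteq> H" "finite H"
    have "distr (P H) (PiM J (\<lambda>_. borel)) (\<lambda>f. restrict f J)
        = distr (measure_pmf (p H)) (PiM J (\<lambda>_. borel)) ((\<lambda>f. restrict f J) \<circ> enc H)"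
      unfolding P_def by (rule distr_distr[OF measurable_restrict_subset[OF JH(1)] enc])
    also have "(\<lambda>f. restrict f J) \<circ> enc H = enc J \<circ> (\<lambda>A. A \<inter> J)"
      using JH by (auto simp: fun_eq_iff enc_def restrict_def)
    also have "distr (measure_pmf (p H)) (PiM J (\<lambda>_. borel)) (enc J \<circ> (\<lambda>A. A \<inter> J))
        = distr (distr (measure_pmf (p H)) (count_space UNIV) (\<lambda>A. A \<inter> J)) (PiM J (\<lambda>_. borel)) (enc J)"
      by (rule distr_distr[symmetric]) (auto simp: enc_def space_PiM PiE_def)
    also have "distr (measure_pmf (p H)) (count_space UNIV) (\<lambda>A. A \<inter> J) = measure_pmf (p J)"
      by (simp add: p_restrict[OF JH(2,1), symmetric] map_pmf_rep_eq)
    finally have "distr (P H) (PiM J (\<lambda>_. borel)) (\<lambda>f. restrict f J) = P J"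
      by (simp only: P_def)
    then show "P J = distr (P H) (PiM J (\<lambda>_. borel)) (\<lambda>f. restrict f J)"
      by (rule sym)
  next
    fix J :: "'x set" assume "finite J" "J \<subseteq> UNIV"
    show "prob_space (P J)"
      unfolding P_def by (intro prob_space.prob_space_distr prob_space_measure_pmf enc)
  qed
  define M where "M = distr L.lim (borel :: ('x \<Rightarrow> bool) measure) (\<lambda>f x. f x = 1)"
  have meas: "(\<lambda>f x. f x = 1) \<in> measurable L.lim (borel :: ('x \<Rightarrow> bool) measure)"
  proof (rule measurable_coordinatewise_then_product)
    fix x
    have "(\<lambda>f. f x) \<in> measurable L.lim (borel :: real measure)"
      by (simp add: measurable_cong_sets[OF L.sets_lim refl])
    then have "(\<lambda>f. f x = 1) \<in> measurable L.lim (count_space UNIV)"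
      by simp
    then show "(\<lambda>f. f x = 1) \<in> borel_measurable L.lim"
      by (simp add: measurable_cong_sets[OF refl, of "borel" "count_space UNIV"] borel_bool)
  qed
  have "prob_space M"
    unfolding M_def by (intro prob_space.prob_space_distr meas) (rule L.P.prob_space_axioms)
  moreover have "sets M = sets borel" by (simp add: M_def)
  moreover have "measure M {\<omega>. \<forall>x\<in>X. \<omega> x} = \<mu> X X" if X: "finite X" for X
  proof -
    define T where "T = (\<Pi>\<^sub>E x\<in>X. {1 :: real})"
    have T: "f \<in> T \<longleftrightarrow> f \<in> extensional X \<and> (\<forall>x\<in>X. f x = 1)" for f
      unfolding T_def by (simp only: PiE_iff singleton_iff conj_commute)
    have T_sets: "T \<in> sets (PiM X (\<lambda>_. borel))"
      unfolding T_def by (rule sets_PiM_I_finite[OF X]) simp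
    have ev: "{\<omega> :: 'x \<Rightarrow> bool. \<forall>x\<in>X. \<omega> x} \<in> sets borel"
    proof -
      let ?O = "\<lambda>x. if x \<in> X then {True} else UNIV"
      have "open (Pi\<^sub>E UNIV ?O)"
        using X by (intro open_PiE finite_subset[of "{x. ?O x \<noteq> UNIV}" X]) (auto simp: discrete_topology_class.open_discrete)
      also have "Pi\<^sub>E UNIV ?O = {\<omega>. \<forall>x\<in>X. \<omega> x}"
        by (auto simp: PiE_def Pi_def split: if_splits)
      finally show ?thesis by (rule borel_open)
    qed
    have "measure M {\<omega>. \<forall>x\<in>X. \<omega> x} = measure L.lim ((\<lambda>f x. f x = 1) -` {\<omega>. \<forall>x\<in>X. \<omega> x} \<inter> space L.lim)"
      unfolding M_def by (rule measure_distr[OF meas ev])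
    also have "(\<lambda>f x. f x = 1) -` {\<omega>. \<forall>x\<in>X. \<omega> x} \<inter> space L.lim
        = prod_emb UNIV (\<lambda>_. borel :: real measure) X T"
      by (auto simp: prod_emb_def space_PiM T)
    also have "measure L.lim \<dots> = measure (P X) T"
      using X T_sets by (intro L.measure_lim_emb) auto
    also have "\<dots> = measure (p X) (enc X -` T)"
      unfolding P_def measure_distr[OF enc T_sets] by simp
    also have "enc X -` T = {A. X \<subseteq> A}"
      by (auto simp: T enc_def)
    also have "measure (p X) {A. X \<subseteq> A} = measure (p X) ({A. X \<subseteq> A} \<inter> set_pmf (p X))"
      by (simp add: measure_Int_set_pmf)
    also have "\<dots> = measure (p X) ({X} \<inter> set_pmf (p X))"
      using X by (intro arg_cong[where f = "measure _"]) (auto simp: set_pmf_eq pmf_p d_def split: if_splits)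
    also have "\<dots> = pmf (p X) X"
      unfolding measure_Int_set_pmf by (simp add: measure_pmf_single)
    finally show ?thesis using X by (simp add: pmf_p d_def)
  qed
  ultimately show ?thesis by blast
qed

section \<open>The point process of a quasifree form\<close>

text \<open>
  A transposition of points acts on matrix indices as an even permutation.
\<close>

lemma pfaffian_pairing_permute_points:
  assumes "p permutes {..<n}"
  shows "pfaffian n (pairing_matrix s (x \<circ> p)) = pfaffian n (pairing_matrix s x)"
  using assms finite_lessThan[of n]
proof (induction arbitrary: x rule: permutes_induct)
  case (swap i j p)
  have "doubled (x \<circ> Transposition.transpose i j) m = doubled x (block_swap i j m)" for m
  proof (cases "even m")
    case True
    then obtain k where "m = 2 * k" by blast
    then show ?thesis by (simp add: doubled_def block_swap_apply(1))
  next
    case False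
    then obtain k where m: "m = 2 * k + 1" by (elim oddE)
    show ?thesis unfolding m block_swap_apply(2) by (simp add: doubled_def)
  qed
  then have "pairing_matrix s (x \<circ> Transposition.transpose i j)
      = (\<lambda>k l. pairing_matrix s x (block_swap i j k) (block_swap i j l))"
    by (simp add: pairing_matrix_def fun_eq_iff)
  then have "pfaffian n (pairing_matrix s (x \<circ> Transposition.transpose i j)) = pfaffian n (pairing_matrix s x)"
    using pfaffian_permute[OF block_swap_permutes, of i n j "pairing_matrix s x"] swap.hyps
    by (simp add: sign_block_swap)
  then show ?case
    using swap.IH[of "x \<circ> Transposition.transpose i j"] by (simp only: comp_assoc)
qed simp_all

lemma pfaffian_pairing_cong:
  assumes "\<And>i. i < n \<Longrightarrow> x i = y i"
  shows "pfaffian n (pairing_matrix s x) = pfaffian n (pairing_matrix s y)"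
  by (rule pfaffian_cong) (use assms in \<open>auto simp: pairing_matrix_def doubled_def\<close>)

text \<open>
  The Pfaffian over a finite set of points; by the next lemma every enumeration of the set gives the
  same value.
\<close>

definition pairing_pfaffian :: "('x \<times> bool \<Rightarrow> 'x \<times> bool \<Rightarrow> complex) \<Rightarrow> 'x set \<Rightarrow> complex" where
  "pairing_pfaffian s X = pfaffian (card X) (pairing_matrix s (SOME x. bij_betw x {..<card X} X))"

lemma pairing_pfaffian_eq:
  assumes x: "bij_betw x {..<n} X"
  shows "pairing_pfaffian s X = pfaffian n (pairing_matrix s x)"
proof -
  have n: "card X = n" using bij_betw_same_card[OF x] by simp
  define y where "y = (SOME x. bij_betw x {..<card X} X)"
  have y: "bij_betw y {..<n} X"
    unfolding y_def n by (rule someI[of _ x]) (rule x)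
  define p where "p i = (if i < n then inv_into {..<n} x (y i) else i)" for i
  have "bij_betw (inv_into {..<n} x \<circ> y) {..<n} {..<n}"
    using y bij_betw_inv_into[OF x] by (rule bij_betw_trans)
  then have "bij_betw p {..<n} {..<n}"
    by (rule bij_betw_cong[THEN iffD1, rotated]) (simp add: p_def)
  then have "p permutes {..<n}"
    by (rule bij_imp_permutes) (simp add: p_def)
  moreover have "y i = (x \<circ> p) i" if "i < n" for i
    using that bij_betw_inv_into_right[OF x, of "y i"] y by (auto simp: p_def bij_betw_def)
  ultimately show ?thesis
    unfolding pairing_pfaffian_def n y_def[symmetric, unfolded n]
    by (simp only: pfaffian_pairing_permute_points pfaffian_pairing_cong[of n y "x \<circ> p"])
qed

lemma obtain_enumeration:
  assumes "finite X"
  obtains x where "bij_betw x {..<card X} X"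
  using ex_bij_betw_nat_finite[OF assms] by (auto simp: atLeast0LessThan)

lemma pairing_pfaffian_nonneg:
  assumes "finite X" "quasifree X s"
  shows "pairing_pfaffian s X \<in> \<real>\<^sub>\<ge>\<^sub>0"
proof -
  obtain x where x: "bij_betw x {..<card X} X" using obtain_enumeration[OF assms(1)] .
  then show ?thesis
    using assms(2) unfolding pairing_pfaffian_eq[OF x]
    by (intro pfaffian_pairing_nonneg) (auto simp: bij_betw_def)
qed

lemma pairing_pfaffian_insert:
  assumes X: "finite X" "y \<notin> X"
  shows "pairing_pfaffian s (insert y X) + pairing_pfaffian (particle_hole {y} s) (insert y X)
    = pairing_pfaffian s X"
proof -
  obtain x where x: "bij_betw x {..<card X} X" using obtain_enumeration[OF X(1)] .
  define x' where "x' = x(card X := y)"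
  have x': "bij_betw x' {..<card X} X"
    using x by (rule bij_betw_cong[THEN iffD1, rotated]) (simp add: x'_def)
  have xy: "bij_betw x' {..<Suc (card X)} (insert y X)"
    unfolding lessThan_Suc using notIn_Un_bij_betw[of "card X" "{..<card X}" x' X] X x'
    by (simp add: x'_def)
  show ?thesis
    using pfaffian_particle_hole[of x' "card X" s] xy
    unfolding pairing_pfaffian_eq[OF x'] pairing_pfaffian_eq[OF xy]
    by (simp add: bij_betw_def x'_def)
qed

lemma particle_hole_insert:
  assumes "y \<notin> C"
  shows "particle_hole (insert y C) s = particle_hole {y} (particle_hole C s)"
proof -
  have "flip (insert y C) u = flip C (flip {y} u)" for u
    using assms by (auto simp: flip_def)
  then show ?thesis by (simp add: particle_hole_def fun_eq_iff)
qed

text \<open>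
  The weight of \<open>A\<close> among the subsets of \<open>X\<close> is the Pfaffian over \<open>X\<close> after the particle-hole
  transformation on \<open>X - A\<close>, which turns the absence of a particle into its presence.
\<close>

lemma exists_quasifree_point_process:
  fixes s :: "'x :: countable \<times> bool \<Rightarrow> 'x \<times> bool \<Rightarrow> complex"
  assumes s: "quasifree UNIV s"
  shows "\<exists>M :: ('x \<Rightarrow> bool) measure. prob_space M \<and> sets M = sets borel \<and>
    (\<forall>n x. complex_of_real (correlation M n x) = pfaffian n (pairing_matrix s x))"
proof -
  define \<mu> where "\<mu> X A = Re (pairing_pfaffian (particle_hole (X - A) s) X)" for X A
  have pos: "pairing_pfaffian (particle_hole C s) X \<in> \<real>\<^sub>\<ge>\<^sub>0" if "finite X" for C X
    using quasifree_particle_hole[OF s] that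
    by (intro pairing_pfaffian_nonneg) (auto simp: quasifree_def)
  have "\<exists>M :: ('x \<Rightarrow> bool) measure. prob_space M \<and> sets M = sets borel \<and>
    (\<forall>X. finite X \<longrightarrow> measure M {\<omega>. \<forall>x\<in>X. \<omega> x} = \<mu> X X)"
  proof (rule exists_configuration_measure[of \<mu>])
    show "0 \<le> \<mu> X A" if "finite X" "A \<subseteq> X" for X A
      using pos[OF that(1)] by (auto simp: \<mu>_def complex_nonneg_Reals_iff)
    show "\<mu> {} {} = 1"
      by (simp add: \<mu>_def pairing_pfaffian_def pfaffian_def)
    show "\<mu> (insert y X) A + \<mu> (insert y X) (insert y A) = \<mu> X A"
      if "finite X" "y \<notin> X" "A \<subseteq> X" for X y A
    proof -
      have sets: "insert y X - A = insert y (X - A)" "insert y X - insert y A = X - A"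
        and y: "y \<notin> X - A"
        using that by auto
      show ?thesis
        using arg_cong[where f = Re, OF pairing_pfaffian_insert[OF that(1,2), of "particle_hole (X - A) s"]]
        unfolding \<mu>_def sets particle_hole_insert[OF y] plus_complex.sel by linarith
    qed
  qed
  then obtain M :: "('x \<Rightarrow> bool) measure" where M: "prob_space M" "sets M = sets borel"
    "\<And>X. finite X \<Longrightarrow> measure M {\<omega>. \<forall>x\<in>X. \<omega> x} = \<mu> X X"
    by blast
  have "complex_of_real (correlation M n x) = pfaffian n (pairing_matrix s x)" for n x
  proof (cases "inj_on x {..<n}")
    case True
    let ?X = "x ` {..<n}"
    have "correlation M n x = measure M {\<omega>. \<forall>x\<in>?X. \<omega> x}"
    proof -
      have "{\<omega>. \<forall>i<n. \<omega> (x i)} = {\<omega>. \<forall>y\<in>?X. \<omega> y}" by auto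
      with True show ?thesis by (simp only: correlation_def if_True)
    qed
    also have "\<dots> = \<mu> ?X ?X" by (rule M(3)) simp
    also have "complex_of_real \<dots> = pairing_pfaffian s ?X"
    proof -
      have "particle_hole {} s = s" by (simp add: particle_hole_def flip_def fun_eq_iff)
      then show ?thesis
        using pos[of ?X "{}"] by (simp add: \<mu>_def complex_nonneg_Reals_iff complex_eq_iff)
    qed
    also have "\<dots> = pfaffian n (pairing_matrix s x)"
      using True by (intro pairing_pfaffian_eq) (simp add: bij_betw_def)
    finally show ?thesis .
  next
    case False
    then obtain i j where ij: "i < n" "j < n" "i \<noteq> j" "x i = x j" by (auto simp: inj_on_def)
    \<comment> \<open>If two points coincide, then so do the matrix rows that belong to their first copies.\<close>
    then have "pfaffian n (pairing_matrix s x) = 0"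
      unfolding pairing_matrix_def[abs_def]
      by (intro pfaffian_noninjective[of "2 * i" n "2 * j"]) (auto simp: doubled_def)
    with False show ?thesis by (simp add: correlation_def)
  qed
  with M show ?thesis by blast
qed

section \<open>The quasifree form of an operator\<close>

lemma ell2_cinner_cscale_right: "ell2_cinner f (ell2_cscale c g) = c * ell2_cinner f g"
  using infsum_cmult_right[OF ell2_cinner_summable[of f g], of c]
  by (simp add: ell2_cinner.rep_eq ell2_cscale.rep_eq mult.left_commute)

lemma dbl_cinner_commute: "dbl_cinner v w = cnj (dbl_cinner w v)"
  by (simp add: dbl_cinner_def flip: ell2_cinner_commute)

lemma dbl_cinner_add_left: "dbl_cinner (u + v) w = dbl_cinner u w + dbl_cinner v w"
  by (simp add: dbl_cinner_def ell2_cinner_add_left)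

lemma dbl_cinner_add_right: "dbl_cinner w (u + v) = dbl_cinner w u + dbl_cinner w v"
  using dbl_cinner_add_left[of u v w] dbl_cinner_commute[of w] by simp

lemma dbl_cinner_cscale_right: "dbl_cinner w (dbl_cscale c v) = c * dbl_cinner w v"
  by (simp add: dbl_cinner_def dbl_cscale_def ell2_cinner_cscale_right distrib_left)

lemma dbl_cinner_cscale_left: "dbl_cinner (dbl_cscale c v) w = cnj c * dbl_cinner v w"
  using dbl_cinner_cscale_right[of w c v] dbl_cinner_commute[of v w] dbl_cinner_commute[of "dbl_cscale c v" w]
  by simp

lemma dbl_cinner_zero [simp]: "dbl_cinner 0 w = 0" "dbl_cinner w 0 = 0"
  using dbl_cinner_add_left[of 0 0 w] dbl_cinner_add_right[of w 0 0] by simp_all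

lemma dbl_cinner_sum_left: "finite F \<Longrightarrow> dbl_cinner (\<Sum>u\<in>F. f u) w = (\<Sum>u\<in>F. dbl_cinner (f u) w)"
  by (induction rule: finite_induct) (simp_all add: dbl_cinner_add_left)

lemma dbl_cinner_sum_right: "finite F \<Longrightarrow> dbl_cinner w (\<Sum>u\<in>F. f u) = (\<Sum>u\<in>F. dbl_cinner w (f u))"
  by (induction rule: finite_induct) (simp_all add: dbl_cinner_add_right)

lemma dbl_cinner_diff_right: "dbl_cinner w (u - v) = dbl_cinner w u - dbl_cinner w v"
  using dbl_cinner_add_right[of w "u - v" v] by simp

lemma ell2_cinner_conj: "ell2_cinner (ell2_conj f) (ell2_conj g) = cnj (ell2_cinner f g)"
  by (simp add: ell2_cinner.rep_eq ell2_conj.rep_eq flip: infsum_cnj)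

lemma dbl_cinner_Gamma: "dbl_cinner (Gamma v) (Gamma w) = cnj (dbl_cinner v w)"
  by (simp add: dbl_cinner_def Gamma_def ell2_cinner_conj add.commute)

definition dbl_basis :: "'x \<times> bool \<Rightarrow> 'x dbl" where
  "dbl_basis u = (if snd u then (0, ell2_basis (fst u)) else (ell2_basis (fst u), 0))"

lemma ell2_conj_basis [simp]: "ell2_conj (ell2_basis x) = ell2_basis x"
  by transfer auto

lemma ell2_conj_zero [simp]: "ell2_conj 0 = 0"
  by transfer auto

lemma Gamma_basis: "Gamma (dbl_basis u) = dbl_basis (other_copy u)"
  by (simp add: Gamma_def dbl_basis_def other_copy_def)

lemma ell2_cinner_basis: "ell2_cinner (ell2_basis x) (ell2_basis y) = of_bool (x = y)"
proof -
  have "ell2_cinner (ell2_basis x) (ell2_basis y)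
      = (\<Sum>\<^sub>\<infinity>z\<in>{x}. cnj (ell2_app (ell2_basis x) z) * ell2_app (ell2_basis y) z)"
    unfolding ell2_cinner.rep_eq by (rule infsum_cong_neutral) (auto simp: ell2_basis.rep_eq)
  then show ?thesis by (simp add: ell2_basis.rep_eq)
qed

lemma ell2_cinner_zero [simp]: "ell2_cinner 0 f = 0" "ell2_cinner f 0 = 0"
  by (simp_all add: ell2_cinner.rep_eq zero_ell2.rep_eq)

lemma dbl_cinner_basis: "dbl_cinner (dbl_basis u) (dbl_basis v) = of_bool (u = v)"
  by (auto simp: dbl_cinner_def dbl_basis_def ell2_cinner_basis prod_eq_iff)

text \<open>
  The matrix of \<open>S\<close> in the standard basis; in the language of quasifree states, the two-point function.
\<close>

definition covariance :: "('x dbl \<Rightarrow> 'x dbl) \<Rightarrow> 'x \<times> bool \<Rightarrow> 'x \<times> bool \<Rightarrow> complex" where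
  "covariance S u v = dbl_cinner (dbl_basis u) (S (dbl_basis v))"

text \<open>
  Duality is the relation \<open>\<Gamma> S \<Gamma> = 1 - S\<close> between basis vectors: \<open>\<Gamma>\<close> is anti-unitary and exchanges the
  basis vectors of the two copies, and \<open>S\<close> is selfadjoint.
\<close>

lemma quasifree_covariance:
  fixes S :: "'x dbl \<Rightarrow> 'x dbl"
  assumes "S \<in> Q_set"
  shows "quasifree X (covariance S)"
proof -
  have lin: "bounded_linear S" and scale: "S (dbl_cscale c v) = dbl_cscale c (S v)"
    and pos: "dbl_cinner v (S v) \<in> \<real>\<^sub>\<ge>\<^sub>0" and sa: "dbl_cinner v (S w) = dbl_cinner (S v) w"
    and bar: "Gamma (S (Gamma v)) = v - S v" for c v w
    using assms unfolding Q_set_def bounded_clinear_op_def op_le_def selfadjoint_op_def op_bar_def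
      mem_Collect_eq fun_eq_iff o_apply diff_zero by blast+
  interpret S: bounded_linear S by (rule lin)
  have herm: "covariance S v u = cnj (covariance S u v)" for u v
    unfolding covariance_def by (subst sa) (rule dbl_cinner_commute)
  have "pos_form (covariance S)"
    unfolding pos_form_def
  proof (intro conjI allI impI)
    show "covariance S v u = cnj (covariance S u v)" for u v by (rule herm)
    fix F :: "('x \<times> bool) set" and w :: "'x \<times> bool \<Rightarrow> complex" assume F: "finite F"
    define W where "W = (\<Sum>u\<in>F. dbl_cscale (w u) (dbl_basis u))"
    have "dbl_cinner W (S W) = (\<Sum>u\<in>F. \<Sum>v\<in>F. cnj (w u) * covariance S u v * w v)"
      unfolding W_def S.sum scale dbl_cinner_sum_left[OF F] dbl_cinner_sum_right[OF F]
        dbl_cinner_cscale_left dbl_cinner_cscale_right covariance_def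
      by (simp add: sum_distrib_left mult_ac) (rule sum.swap)
    with pos[of W] show "0 \<le> Re (\<Sum>u\<in>F. \<Sum>v\<in>F. cnj (w u) * covariance S u v * w v)"
      by (simp add: complex_nonneg_Reals_iff)
  qed
  moreover have "covariance S (other_copy v) (other_copy u) = of_bool (u = v) - covariance S u v" for u v
  proof -
    have "covariance S (other_copy v) (other_copy u)
        = dbl_cinner (Gamma (dbl_basis v)) (S (Gamma (dbl_basis u)))"
      by (simp add: covariance_def Gamma_basis)
    also have "\<dots> = cnj (dbl_cinner (S (Gamma (dbl_basis u))) (Gamma (dbl_basis v)))"
      by (rule dbl_cinner_commute)
    also have "\<dots> = dbl_cinner (Gamma (S (Gamma (dbl_basis u)))) (Gamma (Gamma (dbl_basis v)))"
      by (simp only: dbl_cinner_Gamma)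
    also have "\<dots> = cnj (dbl_cinner (dbl_basis v) (dbl_basis u - S (dbl_basis u)))"
      by (subst dbl_cinner_commute) (use bar[of "dbl_basis u"] in \<open>simp only: Gamma_basis other_copy_simps\<close>)
    also have "\<dots> = of_bool (u = v) - cnj (covariance S v u)"
      by (auto simp: dbl_cinner_diff_right dbl_cinner_basis covariance_def)
    also have "cnj (covariance S v u) = covariance S u v"
      by (rule herm[symmetric])
    finally show ?thesis .
  qed
  ultimately show ?thesis by (simp add: quasifree_def)
qed

lemma kernel_of_eq_pairing:
  "kernel_of S x y $ (if s then 2 else 1) $ (if t then 2 else 1) = pairing (covariance S) (x, s) (y, t)"
proof -
  have diff: "ell2_cinner f (g - h) = ell2_cinner f g - ell2_cinner f h" for f g h :: "'a ell2"
    using dbl_cinner_diff_right[of "(f, 0)" "(g, 0)" "(h, 0)"] by (simp add: dbl_cinner_def)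
  show ?thesis
    by (cases s; cases t)
      (simp_all add: kernel_of_def pairing_def covariance_def dbl_basis_def dbl_cinner_def
        block11_def block12_def block21_def block22_def diff ell2_cinner_basis)
qed

lemma block_matrix_kernel_of: "block_matrix (kernel_of S) x = pairing_matrix (covariance S) x"
proof (intro ext)
  fix p q
  show "block_matrix (kernel_of S) x p q = pairing_matrix (covariance S) x p q"
    using kernel_of_eq_pairing[of S "x (p div 2)" "x (q div 2)" "odd p" "odd q"]
    by (cases "odd p"; cases "odd q") (simp_all add: block_matrix_def pairing_matrix_def doubled_def)
qed

lemma antisymmetric_kernel_of:
  assumes "S \<in> Q_set"
  shows "antisymmetric_kernel (kernel_of S)"
proof -
  have idx: "\<exists>t. i = (if t then 2 else 1)" for i :: 2
    using exhaust_2[of i] by (auto intro: exI[of _ True] exI[of _ False])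
  have "kernel_of S x y $ j $ i = - kernel_of S y x $ i $ j" for x y i j
  proof -
    obtain a where a: "i = (if a then 2 else 1)" using idx[of i] by blast
    obtain b where b: "j = (if b then 2 else 1)" using idx[of j] by blast
    show ?thesis
      unfolding a b kernel_of_eq_pairing
      by (rule pairing_antisym[OF quasifree_covariance[OF assms, of UNIV]]) simp_all
  qed
  then show ?thesis
    unfolding antisymmetric_kernel_def vec_eq_iff Finite_Cartesian_Product.transpose_def
      vec_lambda_beta uminus_vec_def by blast
qed

theorem proposition1p3:
  fixes S :: "('x :: countable) dbl \<Rightarrow> 'x dbl"
  assumes "S \<in> Q_set"
  shows "antisymmetric_kernel (kernel_of S) \<and>
    (\<exists>M :: ('x \<Rightarrow> bool) measure. pfaffian_point_process M \<and>
      (\<forall>n x. complex_of_real (correlation M n x) = pfaffian n (block_matrix (kernel_of S) x)))"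
proof -
  have anti: "antisymmetric_kernel (kernel_of S)"
    using assms by (rule antisymmetric_kernel_of)
  obtain M :: "('x \<Rightarrow> bool) measure" where "prob_space M" "sets M = sets borel"
    "\<And>n x. complex_of_real (correlation M n x) = pfaffian n (block_matrix (kernel_of S) x)"
    using exists_quasifree_point_process[OF quasifree_covariance[OF assms]]
    unfolding block_matrix_kernel_of by blast
  with anti show ?thesis
    unfolding pfaffian_point_process_def by blast
qed

end
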